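(* Let $p$ be a prime, and for $n\ge 1$ let $ES_{2n+1}(p^2)$ denote the extra-special $p$-group of order $p^{2n+1}$ and exponent $p^2$. (i) Every projective representation of $ES_3(p^2)$ is equivalent to an ordinary representation. (ii) For $n>1$, every irreducible projective representation of $ES_{2n+1}(p^2)$ is obtained from an irreducible projective representation of $(\mathbb Z/p\mathbb Z)^{2n}$ via inflation, i.e. it is projectively equivalent to $\tilde\rho\circ\pi$ for some irreducible projective representation $\tilde\rho$ of $ES_{2n+1}(p^2)/Z(ES_{2n+1}(p^2))\cong(\mathbb Z/p\mathbb Z)^{2n}$, where $\pi$ is the quotient map.
   Context: A $p$-group $G$ is called extra-special if its center $Z(G)$ is cyclic of order $p$ and the quotient $G/Z(G)$ is a non-trivial elementary abelian $p$-group. The notation relies on the following fact, quoted as well known: for each $n\ge1$ there are two extra-special $p$-groups of order $p^{2n+1}$ up to isomorphism, with exponents either $p$ or $p^2$; the isomorphism classes with exponent $p$ and $p^2$ are denoted $ES_{2n+1}(p)$ and $ES_{2n+1}(p^2)$ respectively. A projective representation of a group $G$ on a complex vector space $V$ is a map $\rho:G\to \mathrm{GL}(V)$ such that $\rho(x)\rho(y)=\alpha(x,y)\rho(xy)$ for all $x,y\in G$ and suitable scalars $\alpha(x,y)\in\mathbb C^\times$; then $\alpha$ is a 2-cocycle of $G$ with values in the trivial module $\mathbb C^\times$. It is irreducible if $V\neq 0$ and $V$ has no proper nonzero invariant subspace. Two projective representations $\rho_1:G\to\mathrm{GL}(V)$, $\rho_2:G\to \mathrm{GL}(W)$ are projectively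 equivalent if there are an invertible linear map $T:V\to W$ and a map $b:G\to\mathbb C^\times$ with $b(x)T\rho_1(x)T^{-1}=\rho_2(x)$ for all $x\in G$. A projective representation is called equivalent to an ordinary representation if its 2-cocycle $\alpha$ is cohomologous to the trivial 2-cocycle.
   Formalization: For p = 2 both extra-special groups of each order have exponent 4, and all of them are covered, except that (i) excludes the dihedral group of order 8, for which (i) is false (its Schur multiplier is Z/2). *)

theory Defs
  imports Complex_Main "HOL-Algebra.Algebra"
begin

section \<open>Extra-special groups\<close>

definition group_center :: "('a, 'm) monoid_scheme \<Rightarrow> 'a set" where
  "group_center G = {z \<in> carrier G. \<forall>x \<in> carrier G. z \<otimes>\<^bsub>G\<^esub> x = x \<otimes>\<^bsub>G\<^esub> z}"

definition finite_p_group :: "nat \<Rightarrow> ('a, 'm) monoid_scheme \<Rightarrow> bool" where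
  "finite_p_group p G \<longleftrightarrow> group G \<and> finite (carrier G) \<and> (\<exists>k. order G = p ^ k)"

definition elementary_abelian :: "nat \<Rightarrow> ('a, 'm) monoid_scheme \<Rightarrow> bool" where
  "elementary_abelian p A \<longleftrightarrow>
     comm_group A \<and> (\<forall>x \<in> carrier A. x [^]\<^bsub>A\<^esub> p = \<one>\<^bsub>A\<^esub>)"

definition extra_special :: "nat \<Rightarrow> ('a, 'm) monoid_scheme \<Rightarrow> bool" where
  "extra_special p G \<longleftrightarrow>
     finite_p_group p G \<and>
     cyclic_group (G\<lparr>carrier := group_center G\<rparr>) \<and>
     card (group_center G) = p \<and>
     elementary_abelian p (G Mod group_center G) \<and>
     \<not> trivial_group (G Mod group_center G)"

definition group_exponent :: "('a, 'm) monoid_scheme \<Rightarrow> nat" where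
  "group_exponent G = (LEAST m. m > 0 \<and> (\<forall>x \<in> carrier G. x [^]\<^bsub>G\<^esub> m = \<one>\<^bsub>G\<^esub>))"

text \<open>Membership in the class $ES_{2n+1}(p^2)$. For odd $p$ this is a single isomorphism
  class; for $p = 2$ every extra-special group has exponent 4, so both
  isomorphism types of each order satisfy the predicate.\<close>

definition ES_p_squared :: "nat \<Rightarrow> nat \<Rightarrow> ('a, 'm) monoid_scheme \<Rightarrow> bool" where
  "ES_p_squared p n G \<longleftrightarrow>
     extra_special p G \<and> order G = p ^ (2 * n + 1) \<and> group_exponent G = p ^ 2"

text \<open>The dihedral group of order 8 as a semidirect product: $(a, s)$ stands for $r^a t^s$
  with $r^4 = t^2 = 1$ and $t r t^{-1} = r^{-1}$.\<close>

definition dihedral_8 :: "(int \<times> nat) monoid" where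
  "dihedral_8 = \<lparr>carrier = {0..<4} \<times> {0..<2},
     monoid.mult = (\<lambda>(a, s) (b, t). ((a + (-1) ^ s * b) mod 4, (s + t) mod 2)),
     one = (0, 0)\<rparr>"


section \<open>Projective representations\<close>

text \<open>A complex vector space is given by a scalar multiplication
  \<open>scale\<close> on an abelian group type, of arbitrary dimension. Representations and
  cocycles are only constrained on the carrier of the group.\<close>

definition two_cocycle :: "('a, 'm) monoid_scheme \<Rightarrow> ('a \<Rightarrow> 'a \<Rightarrow> complex) \<Rightarrow> bool" where
  "two_cocycle G \<alpha> \<longleftrightarrow>
     (\<forall>x \<in> carrier G. \<forall>y \<in> carrier G. \<alpha> x y \<noteq> 0) \<and>
     (\<forall>x \<in> carrier G. \<forall>y \<in> carrier G. \<forall>z \<in> carrier G.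
        \<alpha> x y * \<alpha> (x \<otimes>\<^bsub>G\<^esub> y) z = \<alpha> y z * \<alpha> x (y \<otimes>\<^bsub>G\<^esub> z))"

definition cohomologous ::
  "('a, 'm) monoid_scheme \<Rightarrow> ('a \<Rightarrow> 'a \<Rightarrow> complex) \<Rightarrow> ('a \<Rightarrow> 'a \<Rightarrow> complex) \<Rightarrow> bool" where
  "cohomologous G \<alpha> \<beta> \<longleftrightarrow>
     (\<exists>b. (\<forall>x \<in> carrier G. b x \<noteq> 0) \<and>
          (\<forall>x \<in> carrier G. \<forall>y \<in> carrier G.
             \<alpha> x y = b x * b y / b (x \<otimes>\<^bsub>G\<^esub> y) * \<beta> x y))"

text \<open>\<open>projective_rep G scale \<rho> \<alpha>\<close>: \<open>\<rho>\<close> is a projective representation of \<open>G\<close> with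
  2-cocycle \<open>\<alpha>\<close>. On a nonzero space the scalars are determined by \<open>\<rho>\<close> and the cocycle
  condition is automatic; requiring it only matters for the zero space.\<close>

definition projective_rep ::
  "('a, 'm) monoid_scheme \<Rightarrow> (complex \<Rightarrow> 'v::ab_group_add \<Rightarrow> 'v) \<Rightarrow>
   ('a \<Rightarrow> 'v \<Rightarrow> 'v) \<Rightarrow> ('a \<Rightarrow> 'a \<Rightarrow> complex) \<Rightarrow> bool" where
  "projective_rep G scale \<rho> \<alpha> \<longleftrightarrow>
     (\<forall>x \<in> carrier G. Vector_Spaces.linear scale scale (\<rho> x) \<and> bij (\<rho> x)) \<and>
     two_cocycle G \<alpha> \<and>
     (\<forall>x \<in> carrier G. \<forall>y \<in> carrier G. \<forall>v.
        \<rho> x (\<rho> y v) = scale (\<alpha> x y) (\<rho> (x \<otimes>\<^bsub>G\<^esub> y) v))"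

definition irreducible_projective_rep ::
  "('a, 'm) monoid_scheme \<Rightarrow> (complex \<Rightarrow> 'v::ab_group_add \<Rightarrow> 'v) \<Rightarrow>
   ('a \<Rightarrow> 'v \<Rightarrow> 'v) \<Rightarrow> bool" where
  "irreducible_projective_rep G scale \<rho> \<longleftrightarrow>
     (\<exists>\<alpha>. projective_rep G scale \<rho> \<alpha>) \<and>
     (UNIV :: 'v set) \<noteq> {0} \<and>
     (\<forall>W. module.subspace scale W \<and> (\<forall>x \<in> carrier G. \<rho> x ` W \<subseteq> W) \<longrightarrow>
          W = {0} \<or> W = UNIV)"

definition projectively_equivalent ::
  "('a, 'm) monoid_scheme \<Rightarrow>
   (complex \<Rightarrow> 'v::ab_group_add \<Rightarrow> 'v) \<Rightarrow> ('a \<Rightarrow> 'v \<Rightarrow> 'v) \<Rightarrow>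
   (complex \<Rightarrow> 'w::ab_group_add \<Rightarrow> 'w) \<Rightarrow> ('a \<Rightarrow> 'w \<Rightarrow> 'w) \<Rightarrow> bool" where
  "projectively_equivalent G scale1 \<rho>1 scale2 \<rho>2 \<longleftrightarrow>
     (\<exists>T b. Vector_Spaces.linear scale1 scale2 T \<and> bij T \<and>
        (\<forall>x \<in> carrier G. b x \<noteq> 0 \<and>
           (\<forall>w. scale2 (b x) (T (\<rho>1 x (inv_into UNIV T w))) = \<rho>2 x w)))"

text \<open>A projective representation with 2-cocycle \<open>\<alpha>\<close> is equivalent to an ordinary
  representation iff \<open>\<alpha>\<close> is cohomologous to the trivial cocycle.\<close>

definition equivalent_to_ordinary ::
  "('a, 'm) monoid_scheme \<Rightarrow> ('a \<Rightarrow> 'a \<Rightarrow> complex) \<Rightarrow> bool" where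
  "equivalent_to_ordinary G \<alpha> \<longleftrightarrow> cohomologous G \<alpha> (\<lambda>_ _. 1)"

definition inflation ::
  "('a, 'm) monoid_scheme \<Rightarrow> 'a set \<Rightarrow> ('a set \<Rightarrow> 'v \<Rightarrow> 'v) \<Rightarrow> 'a \<Rightarrow> 'v \<Rightarrow> 'v" where
  "inflation G N \<sigma> = (\<lambda>x. \<sigma> (N #>\<^bsub>G\<^esub> x))"

end

theory Submission
  imports "HOL-Computational_Algebra.Fundamental_Theorem_Algebra" Defs
begin

text \<open>
  A cocycle \<open>\<alpha>\<close> on \<open>G\<close> defines a central extension \<open>E\<close> of \<open>G\<close> by \<open>\<complex>\<^sup>\<times>\<close>. The key point is that
  the preimage in \<open>E\<close> of the centre \<open>Z\<close> of \<open>G\<close> is central, that is, \<open>\<alpha>(z, x) = \<alpha>(x, z)\<close> for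
  \<open>z\<close> in \<open>Z\<close>. For \<open>n > 1\<close> every \<open>x\<close> commutes with some pair \<open>a, b\<close> whose commutator generates \<open>Z\<close>,
  and a lift of \<open>x\<close> commutes with lifts of \<open>a\<close> and \<open>b\<close> up to scalars, hence with their commutator.
  For \<open>n = 1\<close>, unless \<open>G\<close> is dihedral, \<open>G\<close> is generated by two elements of order \<open>p\<^sup>2\<close>; both
  \<open>p\<close>-th powers generate \<open>Z\<close>, so a lift of a generator of \<open>Z\<close> commutes with lifts of both elements.

  For \<open>n > 1\<close> it follows that in an irreducible projective representation \<open>Z\<close> acts by scalars, so the
  representation descends to \<open>G / Z\<close> projectively. For \<open>n = 1\<close> the commutator subgroup of \<open>E\<close> is cyclic
  of order \<open>p\<close> and maps isomorphically onto \<open>Z\<close>. It thus meets \<open>\<complex>\<^sup>\<times>\<close> trivially, and since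
  \<open>\<complex>\<^sup>\<times>\<close> is divisible its identity character extends to \<open>E\<close>; restricting the extension to the
  canonical section of \<open>E\<close> over \<open>G\<close> exhibits \<open>\<alpha>\<close> as a coboundary.
\<close>

section \<open>Commutators and centres\<close>

context group
begin

definition commutator :: "'a \<Rightarrow> 'a \<Rightarrow> 'a" where
  "commutator x y = x \<otimes> y \<otimes> inv x \<otimes> inv y"

lemma commutator_closed [simp]:
  "x \<in> carrier G \<Longrightarrow> y \<in> carrier G \<Longrightarrow> commutator x y \<in> carrier G"
  by (simp add: commutator_def)

lemma commutator_mult_swap:
  assumes "x \<in> carrier G" "y \<in> carrier G"
  shows "commutator x y \<otimes> (y \<otimes> x) = x \<otimes> y"
proof -
  have "commutator x y \<otimes> (y \<otimes> x) = x \<otimes> y \<otimes> inv x \<otimes> (inv y \<otimes> y) \<otimes> x"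
    using assms by (simp only: commutator_def m_assoc inv_closed m_closed)
  also have "\<dots> = x \<otimes> y \<otimes> (inv x \<otimes> x)"
    using assms by (simp add: m_assoc)
  finally show ?thesis using assms by simp
qed

text \<open>Right cancellation of \<open>y \<otimes> x\<close>. Later commutators are computed by
  bringing \<open>x \<otimes> y\<close> into this shape instead of expanding inverses.\<close>

lemma commutator_unique:
  assumes "x \<in> carrier G" "y \<in> carrier G" "w \<in> carrier G" "x \<otimes> y = w \<otimes> (y \<otimes> x)"
  shows "commutator x y = w"
  using assms commutator_mult_swap[OF assms(1,2)] r_cancel[of "commutator x y" "y \<otimes> x" w]
  by simp

lemma commutator_eq_one_iff:
  assumes "x \<in> carrier G" "y \<in> carrier G"
  shows "commutator x y = \<one> \<longleftrightarrow> x \<otimes> y = y \<otimes> x"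
  using commutator_unique[OF assms, of \<one>] commutator_mult_swap[OF assms] assms by auto

lemma commutator_swap:
  assumes "x \<in> carrier G" "y \<in> carrier G"
  shows "commutator y x = inv (commutator x y)"
  using assms by (simp add: commutator_def inv_mult_group m_assoc)

lemma group_center_closed: "z \<in> group_center G \<Longrightarrow> z \<in> carrier G"
  by (simp add: group_center_def)

lemma group_center_commute: "z \<in> group_center G \<Longrightarrow> x \<in> carrier G \<Longrightarrow> z \<otimes> x = x \<otimes> z"
  by (simp add: group_center_def)

lemma commute_inv:
  assumes "z \<in> carrier G" "x \<in> carrier G" "z \<otimes> x = x \<otimes> z"
  shows "inv z \<otimes> x = x \<otimes> inv z"
proof -
  have "inv z \<otimes> x = inv z \<otimes> (x \<otimes> z) \<otimes> inv z" using assms(1,2) by (simp add: m_assoc)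
  also have "\<dots> = inv z \<otimes> (z \<otimes> x) \<otimes> inv z" by (simp add: assms)
  also have "\<dots> = x \<otimes> inv z" using assms(1,2) by (simp flip: m_assoc)
  finally show ?thesis .
qed

lemma commute_mult:
  assumes "z \<in> carrier G" "w \<in> carrier G" "x \<in> carrier G" "z \<otimes> x = x \<otimes> z" "w \<otimes> x = x \<otimes> w"
  shows "z \<otimes> w \<otimes> x = x \<otimes> (z \<otimes> w)"
  using assms by (metis m_assoc)

lemma centralizer_subgroup:
  assumes "x \<in> carrier G" shows "subgroup {z \<in> carrier G. z \<otimes> x = x \<otimes> z} G"
proof
  show "\<one> \<in> {z \<in> carrier G. z \<otimes> x = x \<otimes> z}" using assms by simp
  show "a \<otimes> b \<in> {z \<in> carrier G. z \<otimes> x = x \<otimes> z}"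
    if "a \<in> {z \<in> carrier G. z \<otimes> x = x \<otimes> z}" "b \<in> {z \<in> carrier G. z \<otimes> x = x \<otimes> z}" for a b
    using that assms commute_mult by blast
  show "inv a \<in> {z \<in> carrier G. z \<otimes> x = x \<otimes> z}" if "a \<in> {z \<in> carrier G. z \<otimes> x = x \<otimes> z}" for a
    using that assms commute_inv by blast
qed blast

lemma group_center_subgroup: "subgroup (group_center G) G"
proof
  show "\<one> \<in> group_center G" by (simp add: group_center_def)
  show "a \<otimes> b \<in> group_center G" if "a \<in> group_center G" "b \<in> group_center G" for a b
    using that commute_mult unfolding group_center_def by blast
  show "inv a \<in> group_center G" if "a \<in> group_center G" for a
    using that commute_inv unfolding group_center_def by blast
qed (auto simp: group_center_def)

lemma subgroup_nat_pow_closed: "subgroup H G \<Longrightarrow> h \<in> H \<Longrightarrow> h [^] (n::nat) \<in> H"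
  by (induction n) (auto simp: subgroup.one_closed subgroup.m_closed)

lemma pow_commute:
  assumes "z \<in> carrier G" "x \<in> carrier G" "z \<otimes> x = x \<otimes> z"
  shows "z [^] (i::int) \<otimes> x = x \<otimes> z [^] i"
  using subgroup_int_pow_closed[OF centralizer_subgroup[OF assms(2)], of z i] assms by simp

text \<open>Moving \<open>y\<close> to the left past \<open>x'\<close> and then past
  \<open>x\<close> creates both commutators; the one with \<open>x'\<close> arises to the right of
  \<open>x\<close>, which is why that one is assumed central.\<close>

lemma commutator_mult_left:
  assumes "x \<in> carrier G" "x' \<in> carrier G" "y \<in> carrier G" "commutator x' y \<in> group_center G"
  shows "commutator (x \<otimes> x') y = commutator x y \<otimes> commutator x' y"
proof (rule commutator_unique)
  have c: "commutator x y \<in> carrier G" "commutator x' y \<in> carrier G" using assms by auto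
  have "x \<otimes> x' \<otimes> y = x \<otimes> (commutator x' y \<otimes> (y \<otimes> x'))"
    using assms by (simp add: commutator_mult_swap m_assoc)
  also have "\<dots> = commutator x' y \<otimes> (x \<otimes> y) \<otimes> x'"
    using assms c group_center_commute[OF assms(4), of x] by (simp flip: m_assoc)
  also have "\<dots> = commutator x' y \<otimes> (commutator x y \<otimes> (y \<otimes> x)) \<otimes> x'"
    using assms by (simp add: commutator_mult_swap)
  also have "\<dots> = (commutator x' y \<otimes> commutator x y) \<otimes> (y \<otimes> (x \<otimes> x'))"
    using assms c by (simp add: m_assoc)
  also have "commutator x' y \<otimes> commutator x y = commutator x y \<otimes> commutator x' y"
    using assms c group_center_commute by simp
  finally show "x \<otimes> x' \<otimes> y = commutator x y \<otimes> commutator x' y \<otimes> (y \<otimes> (x \<otimes> x'))" .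
qed (use assms in auto)

text \<open>Conjugation by \<open>x\<close> multiplies \<open>a\<close> and \<open>b\<close> by central elements, which cancel in the
  commutator.\<close>

lemma commute_commutator:
  assumes x: "x \<in> carrier G" and a: "a \<in> carrier G" and b: "b \<in> carrier G"
    and xa: "commutator x a \<in> group_center G" and xb: "commutator x b \<in> group_center G"
  shows "x \<otimes> commutator a b = commutator a b \<otimes> x"
proof -
  define s t c where "s = commutator x a" and "t = commutator x b" and "c = commutator a b"
  have car: "s \<in> carrier G" "t \<in> carrier G" "c \<in> carrier G" using x a b by (auto simp: s_def t_def c_def)
  have s: "s \<otimes> y = y \<otimes> s" and t: "t \<otimes> y = y \<otimes> t" if "y \<in> carrier G" for y
    using xa xb that group_center_commute by (auto simp: s_def t_def)
  have prod: "x \<otimes> (u \<otimes> v) = commutator x u \<otimes> commutator x v \<otimes> (u \<otimes> v) \<otimes> x"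
    if "u \<in> carrier G" "v \<in> carrier G" "commutator x u \<in> group_center G" "commutator x v \<in> group_center G" for u v
  proof -
    have cv: "commutator x v \<otimes> u = u \<otimes> commutator x v" using that group_center_commute by auto
    have "x \<otimes> (u \<otimes> v) = x \<otimes> u \<otimes> v" using that x by (simp add: m_assoc)
    also have "\<dots> = commutator x u \<otimes> (u \<otimes> x) \<otimes> v"
      using that x by (simp add: commutator_mult_swap)
    also have "\<dots> = commutator x u \<otimes> u \<otimes> (x \<otimes> v)" using that x by (simp add: m_assoc)
    also have "\<dots> = commutator x u \<otimes> u \<otimes> (commutator x v \<otimes> (v \<otimes> x))"
      using that x by (simp add: commutator_mult_swap)
    also have "\<dots> = commutator x u \<otimes> (u \<otimes> commutator x v) \<otimes> (v \<otimes> x)"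
      using that x by (simp add: m_assoc)
    also have "\<dots> = commutator x u \<otimes> commutator x v \<otimes> (u \<otimes> v) \<otimes> x"
      unfolding cv[symmetric] using that x by (simp add: m_assoc)
    finally show ?thesis .
  qed
  \<comment> \<open>\<open>prod\<close> is used forwards for \<open>a, b\<close> and backwards for
    \<open>b, a\<close>. Since \<open>s\<close> and \<open>t\<close> commute, the results differ
    only in the position of \<open>c\<close>, and \<open>b \<otimes> a\<close> cancels.\<close>
  have "x \<otimes> c \<otimes> (b \<otimes> a) = x \<otimes> (a \<otimes> b)"
    using x a b car by (simp add: m_assoc c_def commutator_mult_swap)
  also have "\<dots> = s \<otimes> t \<otimes> (a \<otimes> b) \<otimes> x"
    using prod[OF a b xa xb] by (simp add: s_def t_def)
  also have "\<dots> = s \<otimes> t \<otimes> (c \<otimes> (b \<otimes> a)) \<otimes> x"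
    using a b by (simp add: c_def commutator_mult_swap)
  also have "\<dots> = c \<otimes> (t \<otimes> s \<otimes> (b \<otimes> a) \<otimes> x)"
  proof -
    have eq: "s \<otimes> t \<otimes> c = c \<otimes> (t \<otimes> s)"
      using commute_mult[OF car s[OF car(3)] t[OF car(3)]] s[OF car(2)] by argo
    have "s \<otimes> t \<otimes> (c \<otimes> (b \<otimes> a)) \<otimes> x = s \<otimes> t \<otimes> c \<otimes> ((b \<otimes> a) \<otimes> x)"
      using car x a b by (simp add: m_assoc)
    also have "\<dots> = c \<otimes> (t \<otimes> s \<otimes> (b \<otimes> a) \<otimes> x)"
      unfolding eq using car x a b by (simp add: m_assoc)
    finally show ?thesis .
  qed
  also have "t \<otimes> s \<otimes> (b \<otimes> a) \<otimes> x = x \<otimes> (b \<otimes> a)"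
    using prod[OF b a xb xa] by (simp add: s_def t_def)
  also have "c \<otimes> (x \<otimes> (b \<otimes> a)) = c \<otimes> x \<otimes> (b \<otimes> a)"
    using car x a b by (simp add: m_assoc)
  finally show ?thesis
    using r_cancel[of "x \<otimes> c" "b \<otimes> a" "c \<otimes> x"] car x a b by (simp add: c_def)
qed

end

text \<open>Nilpotency class at most two, where the commutator is a homomorphism in its first
  argument. Besides the extra-special group itself, a central extension in which lifts of the centre
  are central is an instance.\<close>

locale class_two_group = group +
  assumes commutator_central:
    "x \<in> carrier G \<Longrightarrow> y \<in> carrier G \<Longrightarrow> commutator x y \<in> group_center G"
begin

lemma commutator_mult_left':
  "x \<in> carrier G \<Longrightarrow> x' \<in> carrier G \<Longrightarrow> y \<in> carrier G \<Longrightarrow>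
    commutator (x \<otimes> x') y = commutator x y \<otimes> commutator x' y"
  by (simp add: commutator_mult_left commutator_central)

lemma commutator_hom: "y \<in> carrier G \<Longrightarrow> (\<lambda>x. commutator x y) \<in> hom G G"
  by (rule homI) (auto simp: commutator_mult_left')

lemma commutator_pow_left:
  assumes "x \<in> carrier G" "y \<in> carrier G"
  shows "commutator (x [^] (i::int)) y = commutator x y [^] i"
  using hom_int_pow[OF commutator_hom[OF assms(2)] assms(1) is_group is_group] .

lemma commutator_nat_pow_left:
  assumes "x \<in> carrier G" "y \<in> carrier G"
  shows "commutator (x [^] (i::nat)) y = commutator x y [^] i"
  using commutator_pow_left[OF assms, of "int i"] by (simp add: int_pow_int)

lemma commutator_inv_left:
  assumes "x \<in> carrier G" "y \<in> carrier G"
  shows "commutator (inv x) y = inv commutator x y"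
  using commutator_pow_left[OF assms, of "- 1"] assms by (simp add: int_pow_neg)

lemma commutator_self [simp]: "x \<in> carrier G \<Longrightarrow> commutator x x = \<one>"
  by (simp add: commutator_eq_one_iff)

end

section \<open>Extension of characters\<close>

text \<open>Divisibility of the multiplicative group of the complex numbers, on which the extension
  of characters rests.\<close>

lemma complex_nth_root_exists:
  assumes "n > 0" obtains v :: complex where "v ^ n = c"
proof (cases "c = 0")
  case True then show ?thesis using that[of 0] assms by simp
next
  case False
  then have "card {z. z ^ n = c} = n" using card_nth_roots assms by auto
  with assms have "{z. z ^ n = c} \<noteq> {}" by force
  with that show ?thesis by blast
qed

context group
begin

definition character_on :: "'a set \<Rightarrow> ('a \<Rightarrow> complex) \<Rightarrow> bool" where
  "character_on K \<phi> \<longleftrightarrow> (\<forall>x \<in> K. \<phi> x \<noteq> 0) \<and> (\<forall>x \<in> K. \<forall>y \<in> K. \<phi> (x \<otimes> y) = \<phi> x * \<phi> y)"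

lemma character_on_one:
  assumes "subgroup K G" "character_on K \<phi>" shows "\<phi> \<one> = 1"
proof -
  have "\<one> \<in> K" using subgroup.one_closed[OF assms(1)] .
  then have "\<phi> (\<one> \<otimes> \<one>) = \<phi> \<one> * \<phi> \<one>" "\<phi> \<one> \<noteq> 0"
    using assms(2) unfolding character_on_def by blast+
  then show ?thesis by simp
qed

lemma character_on_nat_pow:
  assumes K: "subgroup K G" "character_on K \<phi>" and "x \<in> K"
  shows "\<phi> (x [^] (n::nat)) = \<phi> x ^ n"
  using assms subgroup_nat_pow_closed[OF K(1)]
  by (induction n) (auto simp: character_on_one[OF K] character_on_def mult.commute)

lemma character_on_inv:
  assumes K: "subgroup K G" "character_on K \<phi>" and "x \<in> K"
  shows "\<phi> (inv x) = inverse (\<phi> x)"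
proof -
  have "x \<in> carrier G" using subgroup.mem_carrier[OF K(1) assms(3)] .
  then have "\<phi> (inv x) * \<phi> x = 1"
    using assms subgroup.m_inv_closed[OF K(1)] character_on_one[OF K]
    by (metis character_on_def l_inv)
  then show ?thesis by (metis inverse_unique mult.commute)
qed

lemma character_on_pow:
  assumes K: "subgroup K G" "character_on K \<phi>" and "x \<in> K"
  shows "\<phi> (x [^] (i::int)) = \<phi> x powi i"
proof (cases i)
  case (nonneg n)
  then show ?thesis by (simp add: int_pow_int character_on_nat_pow[OF assms])
next
  case (neg n)
  have "x \<in> carrier G" using subgroup.mem_carrier[OF K(1) assms(3)] .
  then have "x [^] i = inv (x [^] Suc n)" using int_pow_neg_int[of x "Suc n"] neg by simp
  then show ?thesis
    using neg character_on_inv[OF K subgroup_nat_pow_closed[OF K(1) assms(3), of "Suc n"]]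
      character_on_nat_pow[OF assms, of "Suc n"]
    by (simp add: power_int_def nat_add_distrib power_inverse)
qed

text \<open>The extension lives on the products of some \<open>k\<close> in \<open>K\<close> with a
  power of \<open>x\<close> and takes the value \<open>\<phi> k * v powi i\<close> there.
  \<open>compat\<close> makes this well defined, and \<open>comm\<close> says that moving a power of
  \<open>x\<close> past an element of \<open>K\<close> costs a factor in \<open>K\<close> on which
  \<open>\<phi>\<close> is 1.\<close>

lemma extend_character_step:
  assumes K: "subgroup K G" "character_on K \<phi>" and x: "x \<in> carrier G" and v: "v \<noteq> 0"
    and comm: "\<And>i k. k \<in> K \<Longrightarrow> commutator (x [^] (i::int)) k \<in> K \<and> \<phi> (commutator (x [^] i) k) = 1"
    and compat: "\<And>d::int. x [^] d \<in> K \<Longrightarrow> \<phi> (x [^] d) = v powi d"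
  shows "\<exists>K' \<phi>'. subgroup K' G \<and> K \<subseteq> K' \<and> x \<in> K' \<and> character_on K' \<phi>' \<and>
           (\<forall>k \<in> K. \<phi>' k = \<phi> k) \<and> \<phi>' x = v"
proof -
  note sub = subgroup.one_closed[OF K(1)] subgroup.m_closed[OF K(1)] subgroup.m_inv_closed[OF K(1)]
  note car = subgroup.mem_carrier[OF K(1)]
  have mult: "\<phi> (a \<otimes> b) = \<phi> a * \<phi> b" if "a \<in> K" "b \<in> K" for a b
    using K(2) that by (simp add: character_on_def)
  define K' where "K' = {k \<otimes> x [^] (i::int) | k i. k \<in> K}"
  define \<phi>' where "\<phi>' y = (SOME r. \<exists>k (i::int). k \<in> K \<and> y = k \<otimes> x [^] i \<and> r = \<phi> k * v powi i)" for y
  \<comment> \<open>Equal products force \<open>x [^] (i - j) = inv k \<otimes> l\<close>, an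
    element of \<open>K\<close>, where \<open>compat\<close> prescribes the value.\<close>
  have wd: "\<phi> k * v powi i = \<phi> l * v powi j"
    if kl: "k \<in> K" "l \<in> K" and eq: "k \<otimes> x [^] i = l \<otimes> x [^] j" for k l and i j :: int
  proof -
    have "x [^] (i - j) = x [^] i \<otimes> inv (x [^] j)"
      using x by (simp add: int_pow_diff)
    also have "x [^] i = inv k \<otimes> (l \<otimes> x [^] j)"
      using eq kl x car by (metis int_pow_closed inv_solve_left m_closed)
    finally have "x [^] (i - j) = inv k \<otimes> l" using kl car x by (simp add: m_assoc)
    with kl sub compat[of "i - j"] have "v powi (i - j) = inverse (\<phi> k) * \<phi> l"
      by (metis K character_on_inv mult)
    moreover have "v powi i = v powi (i - j) * v powi j"
      using v by (simp flip: power_int_add)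
    moreover have "\<phi> k \<noteq> 0" using K(2) kl by (simp add: character_on_def)
    ultimately show ?thesis by simp
  qed
  have val: "\<phi>' (k \<otimes> x [^] i) = \<phi> k * v powi i" if "k \<in> K" for k and i :: int
    unfolding \<phi>'_def
  proof (rule some_equality)
    show "\<exists>ka ia. ka \<in> K \<and> k \<otimes> x [^] i = ka \<otimes> x [^] (ia::int) \<and> \<phi> k * v powi i = \<phi> ka * v powi ia"
      using that by blast
  qed (use wd[OF that] in metis)
  have move: "x [^] i \<otimes> k = commutator (x [^] i) k \<otimes> k \<otimes> x [^] i" if "k \<in> K" for k and i :: int
    using that x car commutator_mult_swap[of "x [^] i" k] by (simp add: m_assoc)
  have prod: "k \<otimes> x [^] i \<otimes> (l \<otimes> x [^] j) = (k \<otimes> commutator (x [^] i) l \<otimes> l) \<otimes> x [^] (i + j)"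
    if "k \<in> K" "l \<in> K" for k l and i j :: int
  proof -
    have "k \<otimes> x [^] i \<otimes> (l \<otimes> x [^] j) = k \<otimes> (x [^] i \<otimes> l) \<otimes> x [^] j"
      using that x car by (simp add: m_assoc)
    also have "\<dots> = k \<otimes> commutator (x [^] i) l \<otimes> l \<otimes> (x [^] i \<otimes> x [^] j)"
      unfolding move[OF that(2)] using that x car by (simp add: m_assoc)
    finally show ?thesis using x by (simp add: int_pow_mult)
  qed
  have inverse_mem: "inv (k \<otimes> x [^] i) = (commutator (x [^] (- i)) (inv k) \<otimes> inv k) \<otimes> x [^] (- i)"
    if "k \<in> K" for k and i :: int
    using that x car sub move[of "inv k" "- i"] by (simp add: inv_mult_group int_pow_neg)
  have sub': "subgroup K' G"
  proof (rule subgroupI)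
    show "K' \<subseteq> carrier G" using x car by (auto simp: K'_def)
    show "K' \<noteq> {}" using sub by (auto simp: K'_def)
    show "inv a \<in> K'" if mem: "a \<in> K'" for a
    proof -
      obtain k i where a: "k \<in> K" "a = k \<otimes> x [^] (i::int)" using mem unfolding K'_def by blast
      then have "commutator (x [^] (- i)) (inv k) \<otimes> inv k \<in> K" using comm sub by simp
      with a inverse_mem show ?thesis unfolding K'_def by blast
    qed
    show "a \<otimes> b \<in> K'" if mem: "a \<in> K'" "b \<in> K'" for a b
    proof -
      obtain k i l j where a: "k \<in> K" "a = k \<otimes> x [^] (i::int)" and b: "l \<in> K" "b = l \<otimes> x [^] (j::int)"
        using mem unfolding K'_def by blast
      then have "k \<otimes> commutator (x [^] i) l \<otimes> l \<in> K" using comm sub by simp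
      with a b prod show ?thesis unfolding K'_def by blast
    qed
  qed
  have memK: "k \<in> K' \<and> \<phi>' k = \<phi> k" if "k \<in> K" for k
  proof -
    have "k = k \<otimes> x [^] (0::int)" using that car by simp
    then have "k \<in> K'" using that unfolding K'_def by blast
    then show ?thesis using val[OF that, of 0] that car by simp
  qed
  have memx: "x \<in> K' \<and> \<phi>' x = v"
  proof -
    have "x = \<one> \<otimes> x [^] (1::int)" using x by simp
    then have "x \<in> K'" using sub unfolding K'_def by blast
    then show ?thesis using val[of \<one> 1] sub character_on_one[OF K] x by simp
  qed
  have "character_on K' \<phi>'"
    unfolding character_on_def
  proof (intro conjI ballI)
    show "\<phi>' a \<noteq> 0" if "a \<in> K'" for a
      using that val K(2) v by (auto simp: K'_def character_on_def)
    show "\<phi>' (a \<otimes> b) = \<phi>' a * \<phi>' b" if mem: "a \<in> K'" "b \<in> K'" for a b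
    proof -
      obtain k i l j where a: "k \<in> K" "a = k \<otimes> x [^] (i::int)" and b: "l \<in> K" "b = l \<otimes> x [^] (j::int)"
        using mem unfolding K'_def by blast
      have c: "commutator (x [^] i) l \<in> K" "\<phi> (commutator (x [^] i) l) = 1"
        using comm[OF b(1)] by auto
      have "\<phi> (k \<otimes> commutator (x [^] i) l \<otimes> l) = \<phi> k * \<phi> l"
        using a b c sub by (simp add: mult)
      then show ?thesis
        using a b c sub v by (simp add: prod val power_int_add)
    qed
  qed
  with sub' memK memx show ?thesis by blast
qed

text \<open>Let \<open>M\<close> be the least positive exponent with \<open>x [^] M\<close> in
  \<open>K\<close>. All exponents landing in \<open>K\<close> are multiples of \<open>M\<close>, so
  any \<open>M\<close>-th root \<open>v\<close> of \<open>\<phi> (x [^] M)\<close> meets all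
  conditions at once.\<close>

lemma character_root_exists:
  assumes K: "subgroup K G" "character_on K \<phi>" and x: "x \<in> carrier G"
    and pow: "m > 0" "x [^] (m::nat) \<in> K"
  shows "\<exists>v. v \<noteq> 0 \<and> (\<forall>d::int. x [^] d \<in> K \<longrightarrow> \<phi> (x [^] d) = v powi d)"
proof -
  define M where "M = (LEAST m. m > 0 \<and> x [^] (m::nat) \<in> K)"
  have M: "M > 0" "x [^] M \<in> K"
    using LeastI[of "\<lambda>m. m > 0 \<and> x [^] (m::nat) \<in> K"] pow by (auto simp: M_def)
  have least: "M \<le> m" if "m > 0" "x [^] m \<in> K" for m :: nat
    using that by (auto simp: M_def intro: Least_le)
  obtain v where v: "v ^ M = \<phi> (x [^] M)" using complex_nth_root_exists[OF M(1)] .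
  have "\<phi> (x [^] M) \<noteq> 0" using M(2) K(2) by (simp add: character_on_def)
  then have "v \<noteq> 0" using v zero_power[OF M(1)] by metis
  moreover have "\<phi> (x [^] d) = v powi d" if d: "x [^] d \<in> K" for d :: int
  proof -
    have "x [^] d = x [^] (int M * (d div int M) + d mod int M)" by simp
    then have split: "x [^] d = (x [^] M) [^] (d div int M) \<otimes> x [^] (d mod int M)"
      unfolding int_pow_mult[OF x] int_pow_int[symmetric] int_pow_pow[OF x] .
    \<comment> \<open>The power whose exponent is the remainder also lies in \<open>K\<close>, so
      minimality of \<open>M\<close> forces the remainder to be zero.\<close>
    have "x [^] (d mod int M) = inv ((x [^] M) [^] (d div int M)) \<otimes> x [^] d"
      unfolding split using x by (simp flip: m_assoc)
    then have "x [^] (d mod int M) \<in> K"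
      using d M(2) K(1) by (simp add: subgroup.m_closed subgroup.m_inv_closed subgroup_int_pow_closed)
    moreover have "d mod int M = int (nat (d mod int M))" using M by simp
    ultimately have "x [^] nat (d mod int M) \<in> K" by (metis int_pow_int)
    moreover have "nat (d mod int M) < M" using M by (simp add: nat_less_iff)
    ultimately have "nat (d mod int M) = 0" using least by (meson leD not_gr_zero)
    then have "d mod int M = 0" using M(1) pos_mod_sign[of "int M" d] by linarith
    then have d_eq: "d = int M * (d div int M)" by (metis add.right_neutral mult_div_mod_eq)
    have "\<phi> (x [^] d) = \<phi> ((x [^] M) [^] (d div int M))"
      using x by (subst d_eq) (simp add: int_pow_pow flip: int_pow_int)
    also have "\<dots> = (v ^ M) powi (d div int M)" using character_on_pow[OF K M(2)] v by simp
    also have "\<dots> = v powi d"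
      by (subst (2) d_eq) (simp add: power_int_mult)
    finally show ?thesis .
  qed
  ultimately show ?thesis by blast
qed

text \<open>One element of \<open>S\<close> is adjoined at a time. All commutators already lie in
  \<open>K\<close> with value 1, so the commutator condition of the one-step extension survives at
  every stage, while \<open>torsion\<close> supplies the exponent for the root.\<close>

lemma extend_character:
  assumes K: "subgroup K G" "character_on K \<phi>"
    and comm: "\<And>x y. x \<in> carrier G \<Longrightarrow> y \<in> carrier G \<Longrightarrow> commutator x y \<in> K \<and> \<phi> (commutator x y) = 1"
    and torsion: "\<And>x. x \<in> carrier G \<Longrightarrow> \<exists>m>0. x [^] (m::nat) \<in> K"
    and S: "finite S" "S \<subseteq> carrier G"
  shows "\<exists>K' \<phi>'. subgroup K' G \<and> K \<subseteq> K' \<and> S \<subseteq> K' \<and> character_on K' \<phi>' \<and> (\<forall>k \<in> K. \<phi>' k = \<phi> k)"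
  using S
proof (induction S rule: finite_induct)
  case empty
  show ?case using K by blast
next
  case (insert x S)
  then obtain L \<psi> where L: "subgroup L G" "K \<subseteq> L" "S \<subseteq> L" "character_on L \<psi>" "\<forall>k \<in> K. \<psi> k = \<phi> k"
    by auto
  have x: "x \<in> carrier G" using insert by simp
  obtain m :: nat where m: "m > 0" "x [^] m \<in> L" using torsion[OF x] L(2) by blast
  obtain v where v: "v \<noteq> 0" "\<forall>d::int. x [^] d \<in> L \<longrightarrow> \<psi> (x [^] d) = v powi d"
    using character_root_exists[OF L(1,4) x m] by blast
  have "commutator (x [^] i) k \<in> L \<and> \<psi> (commutator (x [^] i) k) = 1" if "k \<in> L" for i :: int and k
    using comm[of "x [^] i" k] x that subgroup.mem_carrier[OF L(1)] L(2,5) by auto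
  then obtain K' \<phi>' where "subgroup K' G \<and> L \<subseteq> K' \<and> x \<in> K' \<and> character_on K' \<phi>' \<and> (\<forall>k \<in> L. \<phi>' k = \<psi> k)"
    using extend_character_step[OF L(1,4) x v(1)] v(2) by blast
  with L show ?case by (intro exI[of _ K'] exI[of _ \<phi>']) auto
qed

end

section \<open>Extra-special groups\<close>

text \<open>The conditions on the quotient by the centre, restated for elements: commutators and
  \<open>p\<close>-th powers are central, and some commutator is nontrivial.\<close>

locale extra_special_group = class_two_group G for G (structure) +
  fixes p :: nat
  assumes prime_p: "Factorial_Ring.prime p"
    and finite_carrier: "finite (carrier G)"
    and card_center: "card (group_center G) = p"
    and pow_p_central: "x \<in> carrier G \<Longrightarrow> x [^] p \<in> group_center G"
    and nonabelian: "\<exists>x \<in> carrier G. \<exists>y \<in> carrier G. commutator x y \<noteq> \<one>"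
begin

lemma p_gt_1: "p > 1"
  using prime_p prime_gt_1_nat by blast

lemma center_pow_p:
  assumes "z \<in> group_center G" shows "z [^] p = \<one>"
proof -
  interpret Z: group "G\<lparr>carrier := group_center G\<rparr>"
    using group_center_subgroup by (rule subgroup_imp_group)
  have "z [^]\<^bsub>G\<lparr>carrier := group_center G\<rparr>\<^esub> p = \<one>"
    using Z.pow_order_eq_1[of z] assms card_center by (simp add: order_def)
  then show ?thesis by (simp flip: nat_pow_consistent)
qed

lemma ord_center:
  assumes "z \<in> group_center G" "z \<noteq> \<one>" shows "ord z = p"
proof -
  have z: "z \<in> carrier G" using assms group_center_closed by blast
  have "ord z dvd p" using center_pow_p[OF assms(1)] pow_eq_id[OF z] by simp
  moreover have "ord z \<noteq> 1" using ord_eq_1[OF z] assms by simp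
  ultimately show ?thesis using prime_p prime_nat_iff by blast
qed

text \<open>A nontrivial central \<open>u\<close> has order \<open>p\<close>, so its first
  \<open>p\<close> powers are distinct and exhaust the \<open>p\<close> elements of the
  centre.\<close>

lemma center_generated:
  assumes "u \<in> group_center G" "u \<noteq> \<one>" "z \<in> group_center G"
  shows "\<exists>i<p. z = u [^] i"
proof -
  have u: "u \<in> carrier G" using assms group_center_closed by blast
  have "card ((\<lambda>i. u [^] i) ` {0..ord u - 1}) = p"
    using ord_inj[OF u] ord_center[OF assms(1,2)] p_gt_1 by (simp add: card_image)
  moreover have "(\<lambda>i. u [^] i) ` {0..ord u - 1} \<subseteq> group_center G"
    using subgroup_nat_pow_closed[OF group_center_subgroup assms(1)] by blast
  moreover have "finite (group_center G)" using card_center p_gt_1 by (intro card_ge_0_finite) simp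
  ultimately have "(\<lambda>i. u [^] i) ` {0..ord u - 1} = group_center G"
    using card_center by (intro card_subset_eq) auto
  then have "z \<in> (\<lambda>i. u [^] i) ` {0..ord u - 1}" using assms(3) by simp
  then obtain i where "i \<le> ord u - 1" "z = u [^] i" by (metis atLeastAtMost_iff imageE)
  then show ?thesis using ord_center[OF assms(1,2)] p_gt_1 by (intro exI[of _ i]) auto
qed

section \<open>Decomposition along a non-commuting pair\<close>

lemma commutator_product_form:
  assumes "g \<in> carrier G" "h \<in> carrier G" "d \<in> carrier G"
    and "commutator d g = \<one>" "commutator d h = \<one>"
  shows "commutator (d \<otimes> g [^] i \<otimes> h [^] j) g = commutator h g [^] (j::nat)"
    and "commutator (d \<otimes> g [^] i \<otimes> h [^] j) h = commutator g h [^] (i::nat)"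
  using assms by (simp_all add: commutator_mult_left' commutator_nat_pow_left)

text \<open>The commutators of such a product with \<open>g\<close> and with \<open>h\<close> depend
  only on \<open>j\<close> and on \<open>i\<close> respectively, as powers of a central element of
  order \<open>p\<close>. This fixes both exponents below \<open>p\<close>, and cancellation fixes
  \<open>d\<close>. Conversely, dividing \<open>x\<close> by a product \<open>q\<close> with the
  same commutators leaves an element of \<open>C\<close>.\<close>

lemma decomposition_bij:
  assumes g: "g \<in> carrier G" and h: "h \<in> carrier G" and gh: "commutator g h \<noteq> \<one>"
  defines "C \<equiv> {d \<in> carrier G. commutator d g = \<one> \<and> commutator d h = \<one>}"
  shows "bij_betw (\<lambda>(d, i, j). d \<otimes> g [^] i \<otimes> h [^] j) (C \<times> {..<p} \<times> {..<p}) (carrier G)"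
proof -
  have hg: "commutator h g \<noteq> \<one>" using gh commutator_eq_one_iff[OF g h] commutator_eq_one_iff[OF h g] by auto
  have pow_inj: "i = j" if "z \<in> group_center G" "z \<noteq> \<one>" "z [^] i = z [^] j" "i < p" "j < p" for z and i j :: nat
    using ord_inj[OF group_center_closed[OF that(1)]] that(3-5) ord_center[OF that(1,2)] by (auto simp: inj_on_def)
  show ?thesis
    unfolding bij_betw_def
  proof
    show "inj_on (\<lambda>(d, i, j). d \<otimes> g [^] i \<otimes> h [^] j) (C \<times> {..<p} \<times> {..<p})"
    proof (rule inj_onI)
      fix s t assume st: "s \<in> C \<times> {..<p} \<times> {..<p}" "t \<in> C \<times> {..<p} \<times> {..<p}"
        "(case s of (d, i, j) \<Rightarrow> d \<otimes> g [^] i \<otimes> h [^] j) = (case t of (d, i, j) \<Rightarrow> d \<otimes> g [^] i \<otimes> h [^] j)"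
      obtain d i j d' i' j' where s: "s = (d, i, j)" and t: "t = (d', i', j')" by (metis prod_cases3)
      have d: "d \<in> C" "d' \<in> C" and ij: "i < p" "j < p" "i' < p" "j' < p"
        and eq: "d \<otimes> g [^] i \<otimes> h [^] j = d' \<otimes> g [^] i' \<otimes> h [^] j'"
        using st s t by auto
      have dc: "d \<in> carrier G" "d' \<in> carrier G" using d by (auto simp: C_def)
      have "commutator h g [^] j = commutator h g [^] j'"
        using eq commutator_product_form(1)[OF g h] d unfolding C_def by (metis (mono_tags, lifting) mem_Collect_eq)
      then have j: "j = j'" using pow_inj commutator_central[OF h g] hg ij by auto
      have "commutator g h [^] i = commutator g h [^] i'"
        using eq commutator_product_form(2)[OF g h] d unfolding C_def by (metis (mono_tags, lifting) mem_Collect_eq)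
      then have i: "i = i'" using pow_inj commutator_central[OF g h] gh ij by auto
      have "d = d'" using eq g h dc unfolding i j by (simp add: m_assoc)
      with i j s t show "s = t" by simp
    qed
    show "(\<lambda>(d, i, j). d \<otimes> g [^] i \<otimes> h [^] j) ` (C \<times> {..<p} \<times> {..<p}) = carrier G"
    proof
      show "(\<lambda>(d, i, j). d \<otimes> g [^] i \<otimes> h [^] j) ` (C \<times> {..<p} \<times> {..<p}) \<subseteq> carrier G"
        using g h by (auto simp: C_def)
      show "carrier G \<subseteq> (\<lambda>(d, i, j). d \<otimes> g [^] i \<otimes> h [^] j) ` (C \<times> {..<p} \<times> {..<p})"
      proof
        fix x assume x: "x \<in> carrier G"
        obtain j where j: "j < p" "commutator x g = commutator h g [^] j"
          using center_generated[OF commutator_central[OF h g] hg commutator_central[OF x g]] by blast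
        obtain i where i: "i < p" "commutator x h = commutator g h [^] i"
          using center_generated[OF commutator_central[OF g h] gh commutator_central[OF x h]] by blast
        define q where "q = g [^] i \<otimes> h [^] j"
        define d where "d = x \<otimes> inv q"
        have q: "q \<in> carrier G" using g h by (simp add: q_def)
        have "commutator q g = commutator x g" "commutator q h = commutator x h"
          using commutator_product_form[OF g h one_closed, of i j] g h i j
          by (simp_all add: q_def commutator_eq_one_iff)
        then have "commutator d g = \<one>" "commutator d h = \<one>"
          using x q g h by (simp_all add: d_def commutator_mult_left' commutator_inv_left)
        then have "d \<in> C" using x q by (simp add: C_def d_def)
        moreover have "x = d \<otimes> g [^] i \<otimes> h [^] j"
          using x q g h by (simp add: d_def q_def m_assoc)
        ultimately show "x \<in> (\<lambda>(d, i, j). d \<otimes> g [^] i \<otimes> h [^] j) ` (C \<times> {..<p} \<times> {..<p})"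
          using i j by (intro image_eqI[of _ _ "(d, i, j)"]) auto
      qed
    qed
  qed
qed

lemma card_double_centralizer:
  assumes "g \<in> carrier G" "h \<in> carrier G" "commutator g h \<noteq> \<one>"
  shows "order G = card {d \<in> carrier G. commutator d g = \<one> \<and> commutator d h = \<one>} * p ^ 2"
  using bij_betw_same_card[OF decomposition_bij[OF assms]]
  by (simp add: card_cartesian_product order_def power2_eq_square)

lemma decomposition:
  assumes "g \<in> carrier G" "h \<in> carrier G" "commutator g h \<noteq> \<one>" "x \<in> carrier G"
  obtains d and i j :: nat where "d \<in> carrier G" "commutator d g = \<one>" "commutator d h = \<one>"
    "i < p" "j < p" "x = d \<otimes> g [^] i \<otimes> h [^] j"
proof -
  have "x \<in> (\<lambda>(d, i, j). d \<otimes> g [^] i \<otimes> h [^] j) ` ({d \<in> carrier G. commutator d g = \<one> \<and> commutator d h = \<one>} \<times> {..<p} \<times> {..<p})"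
    using bij_betw_imp_surj_on[OF decomposition_bij[OF assms(1-3)]] assms(4) by simp
  then show ?thesis using that by auto
qed

lemma central_commutator_eq_one:
  "z \<in> group_center G \<Longrightarrow> x \<in> carrier G \<Longrightarrow> commutator z x = \<one>"
  by (simp add: commutator_eq_one_iff group_center_commute group_center_closed)

text \<open>The double centralizer has order \<open>p\<close> by counting and contains the centre,
  which also has order \<open>p\<close>.\<close>

lemma double_centralizer_eq_center:
  assumes ord: "order G = p ^ 3" and gh: "g \<in> carrier G" "h \<in> carrier G" "commutator g h \<noteq> \<one>"
  shows "{d \<in> carrier G. commutator d g = \<one> \<and> commutator d h = \<one>} = group_center G"
proof -
  have "card {d \<in> carrier G. commutator d g = \<one> \<and> commutator d h = \<one>} * p ^ 2 = p * p ^ 2"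
    unfolding card_double_centralizer[OF gh, symmetric] ord by (simp add: eval_nat_numeral)
  then have "card {d \<in> carrier G. commutator d g = \<one> \<and> commutator d h = \<one>} = card (group_center G)"
    unfolding card_center using p_gt_1 by (subst (asm) mult_right_cancel) auto
  moreover have sub: "group_center G \<subseteq> {d \<in> carrier G. commutator d g = \<one> \<and> commutator d h = \<one>}"
    using gh central_commutator_eq_one group_center_closed by blast
  moreover have "finite {d \<in> carrier G. commutator d g = \<one> \<and> commutator d h = \<one>}"
    using finite_carrier by simp
  ultimately show ?thesis using card_subset_eq[OF _ sub] by simp
qed

lemma decomposition_center:
  assumes ord: "order G = p ^ 3" and gh: "g \<in> carrier G" "h \<in> carrier G" "commutator g h \<noteq> \<one>"
    and x: "x \<in> carrier G"
  obtains z and i j :: nat where "z \<in> group_center G" "i < p" "j < p" "x = z \<otimes> g [^] i \<otimes> h [^] j"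
proof -
  obtain d and i j :: nat where d: "d \<in> carrier G" "commutator d g = \<one>" "commutator d h = \<one>"
    and ij: "i < p" "j < p" "x = d \<otimes> g [^] i \<otimes> h [^] j"
    using decomposition[OF gh x] .
  have "d \<in> group_center G"
    unfolding double_centralizer_eq_center[OF ord gh, symmetric] using d by simp
  then show ?thesis using that ij by blast
qed

text \<open>If the centralizer of \<open>x\<close> were abelian, its intersection with the centralizer of
  any \<open>y\<close> not commuting with \<open>x\<close> would be central, forcing \<open>|G| = p\<^sup>3\<close>.\<close>

lemma noncommuting_pair_in_centralizer:
  assumes ord: "order G = p ^ (2 * n + 1)" "n > 1" and x: "x \<in> carrier G"
  obtains a b where "a \<in> carrier G" "b \<in> carrier G" "commutator x a = \<one>" "commutator x b = \<one>"
    "commutator a b \<noteq> \<one>"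
proof (cases "\<exists>y \<in> carrier G. commutator x y \<noteq> \<one>")
  case False
  then show ?thesis using nonabelian that by blast
next
  case True
  then obtain y where y: "y \<in> carrier G" "commutator x y \<noteq> \<one>" by blast
  define C where "C = {d \<in> carrier G. commutator d x = \<one> \<and> commutator d y = \<one>}"
  have swap: "commutator u v = \<one> \<longleftrightarrow> commutator v u = \<one>" if "u \<in> carrier G" "v \<in> carrier G" for u v
    using that by (auto simp: commutator_eq_one_iff)
  have "\<not> C \<subseteq> group_center G"
  proof
    assume "C \<subseteq> group_center G"
    then have "card C \<le> p"
      using card_center p_gt_1 by (metis card_ge_0_finite card_mono less_trans zero_less_one)
    then have "order G \<le> p * p ^ 2"
      using card_double_centralizer[OF x y] by (simp add: C_def)
    also have "\<dots> = p ^ 3" by (simp add: eval_nat_numeral)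
    also have "\<dots> < p ^ (2 * n + 1)" using ord(2) p_gt_1 by (intro power_strict_increasing) auto
    finally show False using ord by simp
  qed
  then obtain d where d: "d \<in> C" "d \<notin> group_center G" by blast
  then have dc: "d \<in> carrier G" "commutator d x = \<one>" "commutator d y = \<one>" by (auto simp: C_def)
  obtain e where e: "e \<in> carrier G" "commutator d e \<noteq> \<one>"
    using d dc by (auto simp: group_center_def commutator_eq_one_iff)
  \<comment> \<open>\<open>e\<close> need not commute with \<open>x\<close>, so it is replaced by
    its component \<open>c\<close> in \<open>C\<close>. The other factors are powers of
    \<open>x\<close> and \<open>y\<close>, which commute with \<open>d\<close>, so the commutator
    with \<open>d\<close> does not change.\<close>
  obtain c i j where c: "c \<in> carrier G" "commutator c x = \<one>" "commutator c y = \<one>"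
    and e_eq: "e = c \<otimes> x [^] (i::nat) \<otimes> y [^] (j::nat)"
    using decomposition[OF x y e(1)] by metis
  have "commutator e d = commutator c d"
    using c x y(1) dc swap[OF dc(1)] unfolding e_eq
    by (simp add: commutator_mult_left' commutator_nat_pow_left)
  then have "commutator d c \<noteq> \<one>" using e c dc swap by metis
  with that[OF dc(1) c(1)] dc c x swap show ?thesis by blast
qed

end

section \<open>From the definition of extra-special to conditions on elements\<close>

lemma (in group) quotient_commutator_mem:
  assumes N: "N \<lhd> G" and comm: "comm_group (G Mod N)" and xy: "x \<in> carrier G" "y \<in> carrier G"
  shows "commutator x y \<in> N"
proof -
  interpret N: normal N G by (rule N)
  have "N #> (x \<otimes> y) = N #> (y \<otimes> x)"
    using comm_groupE(4)[OF comm, of "N #> x" "N #> y"] xy by (simp add: carrier_FactGroup N.rcos_sum)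
  then have "x \<otimes> y \<in> N #> (y \<otimes> x)"
    using rcos_self[of "x \<otimes> y" N] N.is_subgroup xy by simp
  then obtain w where w: "w \<in> N" "x \<otimes> y = w \<otimes> (y \<otimes> x)" by (auto simp: r_coset_def)
  then show ?thesis using commutator_unique[OF xy, of w] N.mem_carrier by auto
qed

lemma (in group) group_center_normal: "group_center G \<lhd> G"
proof (rule normal_invI[OF group_center_subgroup])
  show "x \<otimes> h \<otimes> inv x \<in> group_center G" if "x \<in> carrier G" "h \<in> group_center G" for x h
    using that group_center_closed[OF that(2)] group_center_commute[OF that(2) that(1)]
    by (metis inv_closed m_assoc r_inv r_one)
qed

lemma extra_special_group_of_extra_special:
  fixes G (structure)
  assumes p: "Factorial_Ring.prime p" and E: "extra_special p G"
  shows "extra_special_group G p"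
proof -
  interpret group G using E by (simp add: extra_special_def finite_p_group_def)
  let ?Z = "group_center G"
  interpret Z: normal ?Z G by (rule group_center_normal)
  have quot: "comm_group (G Mod ?Z)" and pow: "\<And>C. C \<in> carrier (G Mod ?Z) \<Longrightarrow> C [^]\<^bsub>(G Mod ?Z)\<^esub> p = ?Z"
    using E by (auto simp: extra_special_def elementary_abelian_def)
  have mem: "x \<in> ?Z" if "?Z #>\<^bsub>G\<^esub> x = ?Z" "x \<in> carrier G" for x
    using rcos_self[OF that(2) group_center_subgroup] that(1) by simp
  show ?thesis
  proof
    show "Factorial_Ring.prime p" by (rule p)
    show "finite (carrier G)" "card ?Z = p"
      using E by (auto simp: extra_special_def finite_p_group_def)
    show "commutator x y \<in> ?Z" if "x \<in> carrier G" "y \<in> carrier G" for x y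
      using quotient_commutator_mem[OF group_center_normal quot that] .
    show "x [^] p \<in> ?Z" if "x \<in> carrier G" for x
    proof (rule mem)
      show "?Z #>\<^bsub>G\<^esub> x [^] p = ?Z"
        using pow[of "?Z #> x"] Z.FactGroup_pow[OF that, of p] that unfolding carrier_FactGroup by blast
    qed (use that in simp)
    show "\<exists>x \<in> carrier G. \<exists>y \<in> carrier G. commutator x y \<noteq> \<one>"
    \<comment> \<open>If all commutators were trivial, the centre would be the whole group and the
      quotient trivial.\<close>
    proof (rule ccontr)
      assume "\<not> ?thesis"
      then have "carrier G \<subseteq> ?Z" unfolding group_center_def using commutator_eq_one_iff by blast
      then have "carrier (G Mod ?Z) = {?Z}"
        using coset_join2[OF _ group_center_subgroup] one_closed unfolding carrier_FactGroup by blast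
      then have "trivial_group (G Mod ?Z)"
        using Z.factorgroup_is_group by (simp add: trivial_group_def)
      then show False using E by (simp add: extra_special_def)
    qed
  qed
qed

section \<open>Central extensions of extra-special groups\<close>

text \<open>Any surjection onto \<open>G\<close> with central kernel; the kernel stays abstract
  until the extension is built from a cocycle.\<close>

locale central_extension = Q: extra_special_group G p + E: group E
  for G (structure) and p :: nat and E :: "('e, 'k) monoid_scheme" +
  fixes \<pi> :: "'e \<Rightarrow> 'a"
  assumes pi_hom: "\<pi> \<in> hom E G"
    and pi_surj: "\<pi> ` carrier E = carrier G"
    and kernel_central: "a \<in> carrier E \<Longrightarrow> \<pi> a = \<one> \<Longrightarrow> a \<in> group_center E"
begin

sublocale P: group_hom E G \<pi>
  by (simp add: group_hom_def group_hom_axioms_def pi_hom E.is_group Q.is_group)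

lemma pi_commutator:
  "x \<in> carrier E \<Longrightarrow> y \<in> carrier E \<Longrightarrow> \<pi> (E.commutator x y) = Q.commutator (\<pi> x) (\<pi> y)"
  by (simp add: E.commutator_def Q.commutator_def)

lemma lift:
  assumes "x \<in> carrier G" obtains x' where "x' \<in> carrier E" "\<pi> x' = x"
  using assms pi_surj by (metis imageE)

lemma lift_eq:
  assumes "x \<in> carrier E" "y \<in> carrier E" "\<pi> x = \<pi> y"
  obtains a where "a \<in> group_center E" "\<pi> a = \<one>" "x = a \<otimes>\<^bsub>E\<^esub> y"
proof (rule that[of "x \<otimes>\<^bsub>E\<^esub> inv\<^bsub>E\<^esub> y"])
  show pi1: "\<pi> (x \<otimes>\<^bsub>E\<^esub> inv\<^bsub>E\<^esub> y) = \<one>" using assms by simp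
  show "x \<otimes>\<^bsub>E\<^esub> inv\<^bsub>E\<^esub> y \<in> group_center E"
    using assms pi1 by (intro kernel_central) auto
  show "x = x \<otimes>\<^bsub>E\<^esub> inv\<^bsub>E\<^esub> y \<otimes>\<^bsub>E\<^esub> y" using assms by (simp add: E.m_assoc)
qed

text \<open>\<open>\<pi> t\<close> generates the centre of \<open>G\<close>, so
  \<open>\<zeta>\<close> is a power of \<open>t\<close> up to a kernel element. Proving
  \<open>\<zeta>\<close> central thus reduces to commutation with \<open>t\<close>.\<close>

lemma center_lift_multiple:
  assumes t: "t \<in> carrier E" "\<pi> t \<in> group_center G" "\<pi> t \<noteq> \<one>"
    and \<zeta>: "\<zeta> \<in> carrier E" "\<pi> \<zeta> \<in> group_center G"
  obtains a and i :: nat where "a \<in> group_center E" "\<zeta> = a \<otimes>\<^bsub>E\<^esub> t [^]\<^bsub>E\<^esub> i"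
proof -
  obtain i :: nat where "\<pi> \<zeta> = \<pi> t [^] i" using Q.center_generated[OF t(2,3) \<zeta>(2)] by blast
  then have "\<pi> \<zeta> = \<pi> (t [^]\<^bsub>E\<^esub> i)" using P.hom_nat_pow[OF t(1)] by simp
  with that lift_eq[OF \<zeta>(1) E.nat_pow_closed[OF t(1)]] show ?thesis by metis
qed

lemma multiple_commute:
  assumes "a \<in> group_center E" "t \<in> carrier E" "x \<in> carrier E" "t \<otimes>\<^bsub>E\<^esub> x = x \<otimes>\<^bsub>E\<^esub> t"
  shows "a \<otimes>\<^bsub>E\<^esub> t [^]\<^bsub>E\<^esub> (i::nat) \<otimes>\<^bsub>E\<^esub> x = x \<otimes>\<^bsub>E\<^esub> (a \<otimes>\<^bsub>E\<^esub> t [^]\<^bsub>E\<^esub> i)"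
  using E.commute_mult[OF E.group_center_closed[OF assms(1)] E.nat_pow_closed[OF assms(2)] assms(3)
      E.group_center_commute[OF assms(1,3)]] E.pow_commute[OF assms(2-4), of "int i"]
  by (simp add: int_pow_int)

text \<open>The commuting pair, and with it \<open>t\<close>, is chosen anew for each
  \<open>x\<close>. The commutators of \<open>x\<close> with the lifts \<open>a'\<close> and
  \<open>b'\<close> lie in the kernel, hence are central, as \<open>commute_commutator\<close>
  requires.\<close>

lemma center_lift_central_large:
  assumes ord: "order G = p ^ (2 * n + 1)" "n > 1"
    and \<zeta>: "\<zeta> \<in> carrier E" "\<pi> \<zeta> \<in> group_center G"
  shows "\<zeta> \<in> group_center E"
proof -
  have "\<zeta> \<otimes>\<^bsub>E\<^esub> x = x \<otimes>\<^bsub>E\<^esub> \<zeta>" if x: "x \<in> carrier E" for x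
  proof -
    obtain a b where ab: "a \<in> carrier G" "b \<in> carrier G" "Q.commutator (\<pi> x) a = \<one>"
        "Q.commutator (\<pi> x) b = \<one>" "Q.commutator a b \<noteq> \<one>"
      using Q.noncommuting_pair_in_centralizer[OF ord P.hom_closed[OF x]] .
    obtain a' where a': "a' \<in> carrier E" "\<pi> a' = a" using lift[OF ab(1)] .
    obtain b' where b': "b' \<in> carrier E" "\<pi> b' = b" using lift[OF ab(2)] .
    define t where "t = E.commutator a' b'"
    have t: "t \<in> carrier E" "\<pi> t = Q.commutator a b"
      using a' b' by (auto simp: t_def pi_commutator)
    have "t \<otimes>\<^bsub>E\<^esub> x = x \<otimes>\<^bsub>E\<^esub> t"
      using E.commute_commutator[OF x a'(1) b'(1)] kernel_central[of "E.commutator x a'"]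
        kernel_central[of "E.commutator x b'"] x a' b' ab
      by (simp add: pi_commutator t_def)
    moreover obtain c and i :: nat where "c \<in> group_center E" "\<zeta> = c \<otimes>\<^bsub>E\<^esub> t [^]\<^bsub>E\<^esub> i"
      using center_lift_multiple[OF t(1) _ _ \<zeta>] t(2) ab(5) Q.commutator_central[OF ab(1,2)] by metis
    ultimately show ?thesis using multiple_commute t(1) x by metis
  qed
  with \<zeta>(1) show ?thesis by (simp add: group_center_def)
qed

text \<open>The \<open>p\<close>-th power \<open>t\<close> of \<open>g\<close> commutes with \<open>g\<close>, and with \<open>h\<close> because modulo the
  kernel it is a power of \<open>h\<close>.\<close>

lemma center_lift_central_small:
  assumes ord: "order G = p ^ 3"
    and g: "g \<in> carrier G" "g [^] p \<noteq> \<one>" and h: "h \<in> carrier G" "h [^] p \<noteq> \<one>"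
    and gh: "Q.commutator g h \<noteq> \<one>"
    and \<zeta>: "\<zeta> \<in> carrier E" "\<pi> \<zeta> \<in> group_center G"
  shows "\<zeta> \<in> group_center E"
proof -
  obtain g' where g': "g' \<in> carrier E" "\<pi> g' = g" using lift[OF g(1)] .
  obtain h' where h': "h' \<in> carrier E" "\<pi> h' = h" using lift[OF h(1)] .
  define t where "t = g' [^]\<^bsub>E\<^esub> p"
  have t: "t \<in> carrier E" "\<pi> t = g [^] p" using g' P.hom_nat_pow[OF g'(1), of p] by (auto simp: t_def)
  then have tc: "\<pi> t \<in> group_center G" "\<pi> t \<noteq> \<one>" using Q.pow_p_central[OF g(1)] g(2) by simp_all
  have hp: "h' [^]\<^bsub>E\<^esub> p \<in> carrier E" "\<pi> (h' [^]\<^bsub>E\<^esub> p) = h [^] p" using h' P.hom_nat_pow[OF h'(1), of p] by auto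
  have tg: "t \<otimes>\<^bsub>E\<^esub> g' = g' \<otimes>\<^bsub>E\<^esub> t"
    using E.pow_commute[OF g'(1) g'(1) refl, of "int p"] by (simp add: t_def int_pow_int)
  obtain a and k :: nat where a: "a \<in> group_center E" "t = a \<otimes>\<^bsub>E\<^esub> (h' [^]\<^bsub>E\<^esub> p) [^]\<^bsub>E\<^esub> k"
    using center_lift_multiple[OF hp(1) _ _ t(1) tc(1)] hp(2) Q.pow_p_central[OF h(1)] h(2) by metis
  have "h' [^]\<^bsub>E\<^esub> p \<otimes>\<^bsub>E\<^esub> h' = h' \<otimes>\<^bsub>E\<^esub> h' [^]\<^bsub>E\<^esub> p"
    using E.pow_commute[OF h'(1) h'(1) refl, of "int p"] by (simp add: int_pow_int)
  then have th: "t \<otimes>\<^bsub>E\<^esub> h' = h' \<otimes>\<^bsub>E\<^esub> t"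
    using multiple_commute[OF a(1) hp(1) h'(1)] a(2) by simp
  have "t \<otimes>\<^bsub>E\<^esub> x = x \<otimes>\<^bsub>E\<^esub> t" if x: "x \<in> carrier E" for x
  proof -
    let ?C = "{z \<in> carrier E. z \<otimes>\<^bsub>E\<^esub> t = t \<otimes>\<^bsub>E\<^esub> z}"
    have C: "subgroup ?C E" using E.centralizer_subgroup[OF t(1)] .
    obtain z and i j :: nat where z: "z \<in> group_center G" "\<pi> x = z \<otimes> g [^] i \<otimes> h [^] j"
      using Q.decomposition_center[OF ord g(1) h(1) gh P.hom_closed[OF x]] .
    \<comment> \<open>The central factor \<open>z\<close> of \<open>\<pi> x\<close> lifts to a power
      of \<open>t\<close>, so up to a kernel element \<open>x\<close> is a word in \<open>t\<close>,
      \<open>g'\<close> and \<open>h'\<close>, all of which commute with \<open>t\<close>.\<close>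
    obtain l :: nat where l: "z = \<pi> t [^] l" using Q.center_generated[OF tc z(1)] by blast
    define y where "y = t [^]\<^bsub>E\<^esub> l \<otimes>\<^bsub>E\<^esub> g' [^]\<^bsub>E\<^esub> i \<otimes>\<^bsub>E\<^esub> h' [^]\<^bsub>E\<^esub> j"
    have "y \<in> carrier E" "\<pi> x = \<pi> y"
      using t(1) g' h' z l by (auto simp: y_def P.hom_nat_pow)
    then obtain b where b: "b \<in> group_center E" "x = b \<otimes>\<^bsub>E\<^esub> y" using lift_eq[OF x] by metis
    have "b \<in> ?C" using b t(1) E.group_center_commute E.group_center_closed by auto
    moreover have "t \<in> ?C" "g' \<in> ?C" "h' \<in> ?C" using t(1) g' h' tg th by auto
    then have "y \<in> ?C"
      unfolding y_def by (intro subgroup.m_closed[OF C] E.subgroup_nat_pow_closed[OF C])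
    ultimately have "x \<in> ?C" using b(2) subgroup.m_closed[OF C] by simp
    then show ?thesis by simp
  qed
  then have t_central: "t \<in> group_center E" using t(1) by (simp add: group_center_def)
  obtain c and i :: nat where "c \<in> group_center E" "\<zeta> = c \<otimes>\<^bsub>E\<^esub> t [^]\<^bsub>E\<^esub> i"
    using center_lift_multiple[OF t(1) tc \<zeta>] .
  then show ?thesis
    using t_central subgroup.m_closed[OF E.group_center_subgroup]
      E.subgroup_nat_pow_closed[OF E.group_center_subgroup] by simp
qed

text \<open>The commutator subgroup of \<open>E\<close> is generated by a single central element \<open>w\<close> of order \<open>p\<close>
  that has non-trivial image in \<open>G\<close>. It therefore meets the kernel trivially, so the character can be
  taken to be \<open>1\<close> on it.\<close>

lemma kernel_character_extends:
  assumes ord: "order G = p ^ 3"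
    and lift_central: "\<And>\<zeta>. \<zeta> \<in> carrier E \<Longrightarrow> \<pi> \<zeta> \<in> group_center G \<Longrightarrow> \<zeta> \<in> group_center E"
    and chi: "E.character_on (kernel E G \<pi>) \<chi>"
  shows "\<exists>\<phi>. E.character_on (carrier E) \<phi> \<and> (\<forall>a \<in> kernel E G \<pi>. \<phi> a = \<chi> a)"
proof -
  \<comment> \<open>Commutators in \<open>E\<close> lie over the centre of \<open>G\<close>, so
    \<open>lift_central\<close> makes them central.\<close>
  interpret E2: class_two_group E
    by unfold_locales (use lift_central pi_commutator Q.commutator_central in auto)
  let ?K = "kernel E G \<pi>"
  have K: "subgroup ?K E" by (rule P.subgroup_kernel)
  obtain g h where gh: "g \<in> carrier G" "h \<in> carrier G" "Q.commutator g h \<noteq> \<one>"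
    using Q.nonabelian by blast
  obtain g' where g': "g' \<in> carrier E" "\<pi> g' = g" using lift[OF gh(1)] .
  obtain h' where h': "h' \<in> carrier E" "\<pi> h' = h" using lift[OF gh(2)] .
  define w where "w = E.commutator h' g'"
  have w: "w \<in> carrier E" using g' h' by (simp add: w_def)
  have pi_w: "\<pi> w = Q.commutator h g" using g' h' by (simp add: w_def pi_commutator)
  have pi_w1: "\<pi> w \<noteq> \<one>"
    unfolding pi_w using gh Q.commutator_eq_one_iff[OF gh(1,2)] Q.commutator_eq_one_iff[OF gh(2,1)] by auto
  have ord_pi_w: "Q.ord (\<pi> w) = p"
    using Q.ord_center[OF _ pi_w1] Q.commutator_central[OF gh(2,1)] pi_w by simp
  \<comment> \<open>The \<open>p\<close>-th power of \<open>h'\<close> lies over the centre and is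
    therefore central. Its commutator with \<open>g'\<close>, which is the \<open>p\<close>-th power
    of \<open>w\<close>, is thus trivial.\<close>
  have "h' [^]\<^bsub>E\<^esub> p \<in> group_center E"
    using lift_central[of "h' [^]\<^bsub>E\<^esub> p"] h' P.hom_nat_pow[OF h'(1), of p] Q.pow_p_central[OF gh(2)] by simp
  then have "E.commutator (h' [^]\<^bsub>E\<^esub> p) g' = \<one>\<^bsub>E\<^esub>"
    using g' h' E.group_center_commute by (simp add: E.commutator_eq_one_iff)
  then have wp: "w [^]\<^bsub>E\<^esub> p = \<one>\<^bsub>E\<^esub>"
    using g' h' by (simp add: w_def E2.commutator_nat_pow_left)
  have K_comm: "E.commutator x k = \<one>\<^bsub>E\<^esub>" if "k \<in> ?K" "x \<in> carrier E" for x k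
    using that kernel_central[of k] E.group_center_commute[of k x]
    by (simp add: kernel_def E.commutator_eq_one_iff)
  have chi1: "\<chi> \<one>\<^bsub>E\<^esub> = 1" using E.character_on_one[OF K chi] .
  \<comment> \<open>Only the trivial power of \<open>w\<close> lies in the kernel, so prescribing
    the value 1 at \<open>w\<close> is compatible with \<open>\<chi>\<close>.\<close>
  have "\<chi> (w [^]\<^bsub>E\<^esub> d) = 1 powi d" if "w [^]\<^bsub>E\<^esub> d \<in> ?K" for d :: int
  proof -
    have "\<pi> w [^] d = \<one>" using that P.hom_int_pow[OF w, of d] by (simp add: kernel_def)
    then have "int p dvd d" using Q.int_pow_eq_id[OF P.hom_closed[OF w]] ord_pi_w by simp
    then obtain q where d: "d = int p * q" by blast
    have "w [^]\<^bsub>E\<^esub> d = (w [^]\<^bsub>E\<^esub> p) [^]\<^bsub>E\<^esub> q"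
      unfolding d int_pow_int[symmetric] E.int_pow_pow[OF w] ..
    with wp chi1 show ?thesis by simp
  qed
  then obtain L \<psi> where L: "subgroup L E" "?K \<subseteq> L" "w \<in> L" "E.character_on L \<psi>"
    "\<forall>k \<in> ?K. \<psi> k = \<chi> k" "\<psi> w = 1"
    using E.extend_character_step[OF K chi w, of 1] K_comm w subgroup.one_closed[OF K] chi1 by auto
  \<comment> \<open>This is the kernel of \<open>\<psi>\<close>. Commutators are shown to lie in it
    first when one entry is \<open>g'\<close> or \<open>h'\<close>, and then in general by
    decomposing the other entry.\<close>
  define N where "N = {c \<in> L. \<psi> c = 1}"
  have \<psi>_mult: "\<psi> (a \<otimes>\<^bsub>E\<^esub> b) = \<psi> a * \<psi> b" if "a \<in> L" "b \<in> L" for a b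
    using L(4) that by (simp add: E.character_on_def)
  have N: "subgroup N E"
  proof
    show "N \<subseteq> carrier E" using subgroup.subset[OF L(1)] by (auto simp: N_def)
    show "\<one>\<^bsub>E\<^esub> \<in> N" using subgroup.one_closed[OF L(1)] E.character_on_one[OF L(1,4)] by (simp add: N_def)
    show "a \<otimes>\<^bsub>E\<^esub> b \<in> N" if "a \<in> N" "b \<in> N" for a b
      using that subgroup.m_closed[OF L(1)] by (simp add: N_def \<psi>_mult)
    show "inv\<^bsub>E\<^esub> a \<in> N" if "a \<in> N" for a
      using that subgroup.m_inv_closed[OF L(1)] E.character_on_inv[OF L(1,4)] by (simp add: N_def)
  qed
  have wN: "w \<in> N" "inv\<^bsub>E\<^esub> w \<in> N" using L subgroup.m_inv_closed[OF N] by (auto simp: N_def)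
  have inv_w: "E.commutator g' h' = inv\<^bsub>E\<^esub> w"
    unfolding w_def using E.commutator_swap[OF h'(1) g'(1)] .
  have decomp: "\<exists>\<zeta> (i::nat) (j::nat). \<zeta> \<in> group_center E \<and> x = \<zeta> \<otimes>\<^bsub>E\<^esub> g' [^]\<^bsub>E\<^esub> i \<otimes>\<^bsub>E\<^esub> h' [^]\<^bsub>E\<^esub> j"
    if x: "x \<in> carrier E" for x
  proof -
    obtain z and i j :: nat where z: "z \<in> group_center G" "\<pi> x = z \<otimes> g [^] i \<otimes> h [^] j"
      using Q.decomposition_center[OF ord gh P.hom_closed[OF x]] .
    define q where "q = g' [^]\<^bsub>E\<^esub> i \<otimes>\<^bsub>E\<^esub> h' [^]\<^bsub>E\<^esub> j"
    define \<zeta> where "\<zeta> = x \<otimes>\<^bsub>E\<^esub> inv\<^bsub>E\<^esub> q"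
    have q: "q \<in> carrier E" "\<pi> q = g [^] i \<otimes> h [^] j" using g' h' by (auto simp: q_def P.hom_nat_pow)
    have zc: "z \<in> carrier G" using Q.group_center_closed[OF z(1)] .
    have "\<pi> \<zeta> = z" using x q z zc gh by (simp add: \<zeta>_def Q.m_assoc Q.inv_solve_right')
    then have "\<zeta> \<in> group_center E" using lift_central[of \<zeta>] x q(1) z(1) by (simp add: \<zeta>_def)
    moreover have "x = \<zeta> \<otimes>\<^bsub>E\<^esub> g' [^]\<^bsub>E\<^esub> i \<otimes>\<^bsub>E\<^esub> h' [^]\<^bsub>E\<^esub> j"
      using x q(1) g' h' E.m_assoc[of \<zeta> "g' [^]\<^bsub>E\<^esub> i" "h' [^]\<^bsub>E\<^esub> j"]
      by (simp add: \<zeta>_def E.m_assoc flip: q_def)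
    ultimately show ?thesis by blast
  qed
  have expand: "E.commutator (\<zeta> \<otimes>\<^bsub>E\<^esub> g' [^]\<^bsub>E\<^esub> i \<otimes>\<^bsub>E\<^esub> h' [^]\<^bsub>E\<^esub> j) y
      = E.commutator g' y [^]\<^bsub>E\<^esub> i \<otimes>\<^bsub>E\<^esub> E.commutator h' y [^]\<^bsub>E\<^esub> j"
    if "\<zeta> \<in> group_center E" "y \<in> carrier E" for \<zeta> y and i j :: nat
  proof -
    have "E.commutator \<zeta> y = \<one>\<^bsub>E\<^esub>"
      using that E.group_center_closed E.group_center_commute by (simp add: E.commutator_eq_one_iff)
    then show ?thesis using that g' h' E.group_center_closed
      by (simp add: E2.commutator_mult_left' E2.commutator_nat_pow_left)
  qed
  note closed = subgroup.m_closed[OF N] E.subgroup_nat_pow_closed[OF N] subgroup.m_inv_closed[OF N]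
    subgroup.one_closed[OF N]
  have gens: "E.commutator g' y \<in> N" "E.commutator h' y \<in> N" if y: "y \<in> carrier E" for y
  proof -
    obtain \<zeta> i j where \<zeta>: "\<zeta> \<in> group_center E" "y = \<zeta> \<otimes>\<^bsub>E\<^esub> g' [^]\<^bsub>E\<^esub> (i::nat) \<otimes>\<^bsub>E\<^esub> h' [^]\<^bsub>E\<^esub> (j::nat)"
      using decomp[OF y] by blast
    have "E.commutator y g' \<in> N" "E.commutator y h' \<in> N"
      unfolding \<zeta>(2) using expand[OF \<zeta>(1)] g' h' wN inv_w closed w_def by simp_all
    then show "E.commutator g' y \<in> N" "E.commutator h' y \<in> N"
      using E.commutator_swap[OF y g'(1)] E.commutator_swap[OF y h'(1)] closed(3) by simp_all
  qed
  have comm: "E.commutator x y \<in> L \<and> \<psi> (E.commutator x y) = 1" if x: "x \<in> carrier E" and y: "y \<in> carrier E" for x y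
  proof -
    obtain \<zeta> i j where \<zeta>: "\<zeta> \<in> group_center E" "x = \<zeta> \<otimes>\<^bsub>E\<^esub> g' [^]\<^bsub>E\<^esub> (i::nat) \<otimes>\<^bsub>E\<^esub> h' [^]\<^bsub>E\<^esub> (j::nat)"
      using decomp[OF x] by blast
    have "E.commutator x y \<in> N"
      unfolding \<zeta>(2) expand[OF \<zeta>(1) y] using gens[OF y] closed by simp
    then show ?thesis by (simp add: N_def)
  qed
  have torsion: "\<exists>m>0. x [^]\<^bsub>E\<^esub> (m::nat) \<in> L" if "x \<in> carrier E" for x
  proof -
    have "x [^]\<^bsub>E\<^esub> order G \<in> ?K"
      using that Q.pow_order_eq_1[of "\<pi> x"] P.hom_nat_pow[OF that, of "order G"] by (simp add: kernel_def)
    moreover have "order G > 0" using ord Q.p_gt_1 by simp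
    ultimately show ?thesis using L(2) by blast
  qed
  \<comment> \<open>A finite set of representatives of the elements of \<open>G\<close> suffices:
    together with the kernel it generates \<open>E\<close>.\<close>
  define s where "s x = (SOME x'. x' \<in> carrier E \<and> \<pi> x' = x)" for x
  have s: "s x \<in> carrier E" "\<pi> (s x) = x" if "x \<in> carrier G" for x
    using someI_ex[of "\<lambda>x'. x' \<in> carrier E \<and> \<pi> x' = x"] lift[OF that] unfolding s_def by metis+
  have "s ` carrier G \<subseteq> carrier E" using s(1) by blast
  then obtain M \<phi> where M: "subgroup M E" "L \<subseteq> M" "s ` carrier G \<subseteq> M" "E.character_on M \<phi>" "\<forall>k \<in> L. \<phi> k = \<psi> k"
    using E.extend_character[OF L(1,4) comm torsion, of "s ` carrier G"] Q.finite_carrier by blast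
  have "carrier E \<subseteq> M"
  proof
    fix x assume x: "x \<in> carrier E"
    have sx: "s (\<pi> x) \<in> carrier E" "\<pi> (s (\<pi> x)) = \<pi> x" using s x by auto
    obtain a where a: "a \<in> group_center E" "\<pi> a = \<one>" "x = a \<otimes>\<^bsub>E\<^esub> s (\<pi> x)"
      using lift_eq[OF x sx(1)] sx(2) by metis
    then have "a \<in> M" using L(2) M(2) E.group_center_closed by (auto simp: kernel_def)
    moreover have "s (\<pi> x) \<in> M" using M(3) x by auto
    ultimately show "x \<in> M" using a(3) subgroup.m_closed[OF M(1)] by metis
  qed
  then have "M = carrier E" using subgroup.subset[OF M(1)] by auto
  with M L show ?thesis by (intro exI[of _ \<phi>]) auto
qed

end

section \<open>The central extension defined by a cocycle\<close>

text \<open>Cocycles are not assumed normalized, so the unit carries the factor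
  \<open>inverse (\<alpha> \<one> \<one>)\<close>.\<close>

definition twisted_product ::
  "('a, 'm) monoid_scheme \<Rightarrow> ('a \<Rightarrow> 'a \<Rightarrow> complex) \<Rightarrow> (complex \<times> 'a) monoid" where
  "twisted_product G \<alpha> = \<lparr>carrier = (UNIV - {0}) \<times> carrier G,
     monoid.mult = (\<lambda>(a, x) (b, y). (a * b * \<alpha> x y, x \<otimes>\<^bsub>G\<^esub> y)),
     one = (inverse (\<alpha> \<one>\<^bsub>G\<^esub> \<one>\<^bsub>G\<^esub>), \<one>\<^bsub>G\<^esub>)\<rparr>"

lemma twisted_product_simps [simp]:
  "carrier (twisted_product G \<alpha>) = (UNIV - {0}) \<times> carrier G"
  "(a, x) \<otimes>\<^bsub>twisted_product G \<alpha>\<^esub> (b, y) = (a * b * \<alpha> x y, x \<otimes>\<^bsub>G\<^esub> y)"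
  "\<one>\<^bsub>twisted_product G \<alpha>\<^esub> = (inverse (\<alpha> \<one>\<^bsub>G\<^esub> \<one>\<^bsub>G\<^esub>), \<one>\<^bsub>G\<^esub>)"
  by (simp_all add: twisted_product_def)

context group
begin

lemma two_cocycle_nonzero: "two_cocycle G \<alpha> \<Longrightarrow> x \<in> carrier G \<Longrightarrow> y \<in> carrier G \<Longrightarrow> \<alpha> x y \<noteq> 0"
  by (simp add: two_cocycle_def)

lemma two_cocycle_eq:
  "two_cocycle G \<alpha> \<Longrightarrow> x \<in> carrier G \<Longrightarrow> y \<in> carrier G \<Longrightarrow> z \<in> carrier G \<Longrightarrow>
    \<alpha> x y * \<alpha> (x \<otimes> y) z = \<alpha> y z * \<alpha> x (y \<otimes> z)"
  by (simp add: two_cocycle_def)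

text \<open>The cocycle identity at the triples (1, 1, x) and (x, 1, 1), after cancelling a nonzero
  value.\<close>

lemma two_cocycle_one:
  assumes "two_cocycle G \<alpha>" "x \<in> carrier G"
  shows "\<alpha> \<one> x = \<alpha> \<one> \<one>" "\<alpha> x \<one> = \<alpha> \<one> \<one>"
  using assms(2) two_cocycle_eq[OF assms(1), of \<one> \<one> x] two_cocycle_eq[OF assms(1), of x \<one> \<one>]
    two_cocycle_nonzero[OF assms(1), of \<one> x] two_cocycle_nonzero[OF assms(1), of x \<one>]
  by simp_all

lemma twisted_product_group:
  assumes \<alpha>: "two_cocycle G \<alpha>"
  shows "group (twisted_product G \<alpha>)"
proof (rule groupI)
  note nz = two_cocycle_nonzero[OF \<alpha>]
  show "U \<otimes>\<^bsub>twisted_product G \<alpha>\<^esub> V \<in> carrier (twisted_product G \<alpha>)"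
    if "U \<in> carrier (twisted_product G \<alpha>)" "V \<in> carrier (twisted_product G \<alpha>)" for U V
    using that nz by (cases U; cases V) auto
  show "\<one>\<^bsub>twisted_product G \<alpha>\<^esub> \<in> carrier (twisted_product G \<alpha>)"
    using nz by simp
  show "U \<otimes>\<^bsub>twisted_product G \<alpha>\<^esub> V \<otimes>\<^bsub>twisted_product G \<alpha>\<^esub> W =
      U \<otimes>\<^bsub>twisted_product G \<alpha>\<^esub> (V \<otimes>\<^bsub>twisted_product G \<alpha>\<^esub> W)"
    if "U \<in> carrier (twisted_product G \<alpha>)" "V \<in> carrier (twisted_product G \<alpha>)"
      "W \<in> carrier (twisted_product G \<alpha>)" for U V W
  proof -
    obtain a x b y c z where U: "U = (a, x)" "V = (b, y)" "W = (c, z)"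
      by (cases U; cases V; cases W) auto
    then have "x \<in> carrier G" "y \<in> carrier G" "z \<in> carrier G" using that by auto
    with two_cocycle_eq[OF \<alpha> this] show ?thesis by (simp add: U m_assoc)
  qed
  show "\<one>\<^bsub>twisted_product G \<alpha>\<^esub> \<otimes>\<^bsub>twisted_product G \<alpha>\<^esub> U = U"
    if mem: "U \<in> carrier (twisted_product G \<alpha>)" for U
  proof -
    obtain a x where U: "U = (a, x)" "x \<in> carrier G" using mem by (cases U) auto
    have "\<alpha> \<one> \<one> \<noteq> 0" using nz by simp
    then show ?thesis using U two_cocycle_one(1)[OF \<alpha> U(2)] by simp
  qed
  show "\<exists>V \<in> carrier (twisted_product G \<alpha>). V \<otimes>\<^bsub>twisted_product G \<alpha>\<^esub> U = \<one>\<^bsub>twisted_product G \<alpha>\<^esub>"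
    if mem: "U \<in> carrier (twisted_product G \<alpha>)" for U
  proof -
    obtain a x where U: "U = (a, x)" "a \<noteq> 0" "x \<in> carrier G" using mem by (cases U) auto
    \<comment> \<open>The scalar is chosen so that the product with \<open>U\<close> has the first
      component of the unit, \<open>inverse (\<alpha> \<one> \<one>)\<close>.\<close>
    define V where "V = (inverse (a * \<alpha> (inv x) x * \<alpha> \<one> \<one>), inv x)"
    have "V \<in> carrier (twisted_product G \<alpha>)" "V \<otimes>\<^bsub>twisted_product G \<alpha>\<^esub> U = \<one>\<^bsub>twisted_product G \<alpha>\<^esub>"
      using U nz by (auto simp: V_def field_simps)
    then show ?thesis by blast
  qed
qed

end

text \<open>Elements over the unit of \<open>G\<close> are central because \<open>\<alpha>\<close>
  takes the same value on (1, y) and (y, 1).\<close>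

lemma twisted_product_central_extension:
  assumes "extra_special_group G p" and \<alpha>: "two_cocycle G \<alpha>"
  shows "central_extension G p (twisted_product G \<alpha>) snd"
proof -
  interpret extra_special_group G p by (rule assms)
  interpret E: group "twisted_product G \<alpha>" by (rule twisted_product_group[OF \<alpha>])
  show ?thesis
  proof
    show "snd \<in> hom (twisted_product G \<alpha>) G"
      by (rule homI) (force simp: twisted_product_def)+
    show "snd ` carrier (twisted_product G \<alpha>) = carrier G"
    proof -
      have "x \<in> snd ` carrier (twisted_product G \<alpha>)" if "x \<in> carrier G" for x
        by (rule image_eqI[of _ _ "(1, x)"]) (use that in auto)
      then show ?thesis by auto
    qed
    show "a \<in> group_center (twisted_product G \<alpha>)"
      if mem: "a \<in> carrier (twisted_product G \<alpha>)" "snd a = \<one>\<^bsub>G\<^esub>" for a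
    proof -
      obtain c where a: "a = (c, \<one>\<^bsub>G\<^esub>)" "c \<noteq> 0" using mem by (cases a) auto
      have "a \<otimes>\<^bsub>twisted_product G \<alpha>\<^esub> (b, y) = (b, y) \<otimes>\<^bsub>twisted_product G \<alpha>\<^esub> a" if "y \<in> carrier G" for b y
        using that two_cocycle_one(1)[OF \<alpha> that] two_cocycle_one(2)[OF \<alpha> that] by (simp add: a)
      then show ?thesis using mem by (auto simp: group_center_def)
    qed
  qed
qed

text \<open>Since the unit has first component \<open>inverse (\<alpha> \<one> \<one>)\<close>, the
  third condition says that \<open>\<phi>\<close> is the identity character on the copy of the
  nonzero complex numbers in the kernel. Evaluating \<open>\<phi>\<close> on the product of (1, x)
  and (1, y) shows that \<open>\<phi> (1, x)\<close>, as a function of \<open>x\<close>, has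
  coboundary \<open>\<alpha>\<close>.\<close>

lemma equivalent_to_ordinary_of_character:
  assumes "group G" and \<alpha>: "two_cocycle G \<alpha>"
    and \<phi>: "\<And>U. U \<in> carrier (twisted_product G \<alpha>) \<Longrightarrow> \<phi> U \<noteq> (0::complex)"
      "\<And>U V. U \<in> carrier (twisted_product G \<alpha>) \<Longrightarrow> V \<in> carrier (twisted_product G \<alpha>) \<Longrightarrow>
        \<phi> (U \<otimes>\<^bsub>twisted_product G \<alpha>\<^esub> V) = \<phi> U * \<phi> V"
      "\<And>c. c \<noteq> 0 \<Longrightarrow> \<phi> (c, \<one>\<^bsub>G\<^esub>) = c * \<alpha> \<one>\<^bsub>G\<^esub> \<one>\<^bsub>G\<^esub>"
  shows "equivalent_to_ordinary G \<alpha>"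
  unfolding equivalent_to_ordinary_def cohomologous_def
proof (intro exI[of _ "\<lambda>x. \<phi> (1, x)"] conjI ballI)
  interpret group G by (rule assms)
  note nz = two_cocycle_nonzero[OF \<alpha>]
  show "\<phi> (1, x) \<noteq> 0" if "x \<in> carrier G" for x using \<phi>(1) that by simp
  show "\<alpha> x y = \<phi> (1, x) * \<phi> (1, y) / \<phi> (1, x \<otimes>\<^bsub>G\<^esub> y) * 1" if "x \<in> carrier G" "y \<in> carrier G" for x y
  proof -
    let ?c = "\<alpha> x y / \<alpha> \<one>\<^bsub>G\<^esub> \<one>\<^bsub>G\<^esub>"
    have "\<phi> (1, x) * \<phi> (1, y) = \<phi> (\<alpha> x y, x \<otimes>\<^bsub>G\<^esub> y)"
      using \<phi>(2)[of "(1, x)" "(1, y)"] that by simp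
    also have "\<dots> = \<phi> (?c, \<one>\<^bsub>G\<^esub>) * \<phi> (1, x \<otimes>\<^bsub>G\<^esub> y)"
      using \<phi>(2)[of "(?c, \<one>\<^bsub>G\<^esub>)" "(1, x \<otimes>\<^bsub>G\<^esub> y)"] that nz[OF that] nz[of "\<one>\<^bsub>G\<^esub>" "\<one>\<^bsub>G\<^esub>"]
        two_cocycle_one[OF \<alpha>, of "x \<otimes>\<^bsub>G\<^esub> y"] by simp
    also have "\<phi> (?c, \<one>\<^bsub>G\<^esub>) = \<alpha> x y"
      using \<phi>(3)[of ?c] nz[OF that] nz[of "\<one>\<^bsub>G\<^esub>" "\<one>\<^bsub>G\<^esub>"] by simp
    finally show ?thesis using \<phi>(1)[of "(1, x \<otimes>\<^bsub>G\<^esub> y)"] that by simp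
  qed
qed

lemma equivalent_to_ordinary_small:
  assumes "extra_special_group G p" and ord: "order G = p ^ 3" and \<alpha>: "two_cocycle G \<alpha>"
    and gh: "g \<in> carrier G" "h \<in> carrier G" "group.commutator G g h \<noteq> \<one>\<^bsub>G\<^esub>"
      "g [^]\<^bsub>G\<^esub> p \<noteq> \<one>\<^bsub>G\<^esub>" "h [^]\<^bsub>G\<^esub> p \<noteq> \<one>\<^bsub>G\<^esub>"
  shows "equivalent_to_ordinary G \<alpha>"
proof -
  interpret extra_special_group G p by (rule assms)
  let ?E = "twisted_product G \<alpha>"
  interpret central_extension G p ?E snd
    by (rule twisted_product_central_extension[OF assms(1) \<alpha>])
  have ker: "kernel ?E G snd = (UNIV - {0}) \<times> {\<one>\<^bsub>G\<^esub>}"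
    by (auto simp: kernel_def)
  have "E.character_on (kernel ?E G snd) (\<lambda>U. fst U * \<alpha> \<one>\<^bsub>G\<^esub> \<one>\<^bsub>G\<^esub>)"
    using two_cocycle_nonzero[OF \<alpha>, of "\<one>\<^bsub>G\<^esub>" "\<one>\<^bsub>G\<^esub>"] unfolding ker by (auto simp: E.character_on_def)
  then obtain \<phi> where \<phi>: "E.character_on (carrier ?E) \<phi>"
    "\<forall>U \<in> kernel ?E G snd. \<phi> U = fst U * \<alpha> \<one>\<^bsub>G\<^esub> \<one>\<^bsub>G\<^esub>"
    using kernel_character_extends[OF ord center_lift_central_small[OF ord gh(1,4,2,5,3)]] by blast
  show ?thesis
    by (rule equivalent_to_ordinary_of_character[OF is_group \<alpha>, of \<phi>])
      (use \<phi> ker in \<open>auto simp: E.character_on_def simp del: twisted_product_simps(2)\<close>)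
qed

text \<open>The pair \<open>(1, z)\<close> lies over the centre and is therefore central in the
  twisted product. Comparing the first components of its two products with \<open>(1, x)\<close>
  gives the symmetry.\<close>

lemma cocycle_symmetric_large:
  assumes "extra_special_group G p" and ord: "order G = p ^ (2 * n + 1)" "n > 1" and \<alpha>: "two_cocycle G \<alpha>"
    and z: "z \<in> group_center G" and x: "x \<in> carrier G"
  shows "\<alpha> z x = \<alpha> x z"
proof -
  interpret extra_special_group G p by (rule assms)
  interpret central_extension G p "twisted_product G \<alpha>" snd
    by (rule twisted_product_central_extension[OF assms(1) \<alpha>])
  have "(1, z) \<in> group_center (twisted_product G \<alpha>)"
    using center_lift_central_large[OF ord, of "(1, z)"] z group_center_closed[OF z] by simp
  then show ?thesis
    using E.group_center_commute[of "(1, z)" "(1, x)"] x by simp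
qed

section \<open>Elements of order \<open>p\<^sup>2\<close>\<close>

text \<open>Collecting all \<open>x\<close> on the left moves each \<open>y\<close> past the later
  ones. There are n(n-1)/2 crossings, each costing one central commutator.\<close>

lemma (in class_two_group) mult_nat_pow:
  assumes x: "x \<in> carrier G" and y: "y \<in> carrier G"
  shows "(x \<otimes> y) [^] (n::nat) = x [^] n \<otimes> y [^] n \<otimes> commutator y x [^] (n * (n - 1) div 2)"
proof (induction n)
  case (Suc n)
  let ?c = "commutator y x" and ?k = "n * (n - 1) div 2"
  have c: "?c [^] i \<in> group_center G" for i :: nat
    using subgroup_nat_pow_closed[OF group_center_subgroup commutator_central[OF y x]] .
  have k: "Suc n * (Suc n - 1) div 2 = n + ?k"
  proof -
    have "Suc n * (Suc n - 1) = n * (n - 1) + 2 * n" by (cases n) (auto simp: algebra_simps)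
    then show ?thesis by simp
  qed
  have yx: "y [^] n \<otimes> x = ?c [^] n \<otimes> (x \<otimes> y [^] n)"
    using commutator_mult_swap[of "y [^] n" x] x y by (simp add: commutator_nat_pow_left)
  have "(x \<otimes> y) [^] Suc n = x [^] n \<otimes> y [^] n \<otimes> (?c [^] ?k \<otimes> (x \<otimes> y))"
    using x y by (simp add: Suc m_assoc)
  also have "?c [^] ?k \<otimes> (x \<otimes> y) = x \<otimes> y \<otimes> ?c [^] ?k"
    using group_center_commute[OF c] x y by simp
  also have "x [^] n \<otimes> y [^] n \<otimes> (x \<otimes> y \<otimes> ?c [^] ?k) = x [^] n \<otimes> (y [^] n \<otimes> x) \<otimes> (y \<otimes> ?c [^] ?k)"
    using x y by (simp add: m_assoc)
  also have "\<dots> = x [^] n \<otimes> (x \<otimes> y [^] n \<otimes> ?c [^] n) \<otimes> (y \<otimes> ?c [^] ?k)"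
    unfolding yx using group_center_commute[OF c, of "x \<otimes> y [^] n" n] x y by simp
  also have "\<dots> = x [^] n \<otimes> x \<otimes> y [^] n \<otimes> (?c [^] n \<otimes> y) \<otimes> ?c [^] ?k"
    using x y by (simp add: m_assoc)
  also have "?c [^] n \<otimes> y = y \<otimes> ?c [^] n"
    using group_center_commute[OF c y] .
  also have "x [^] n \<otimes> x \<otimes> y [^] n \<otimes> (y \<otimes> ?c [^] n) \<otimes> ?c [^] ?k = x [^] Suc n \<otimes> y [^] Suc n \<otimes> (?c [^] n \<otimes> ?c [^] ?k)"
    using x y by (simp add: m_assoc)
  also have "?c [^] n \<otimes> ?c [^] ?k = ?c [^] (Suc n * (Suc n - 1) div 2)"
    unfolding k using x y by (simp add: nat_pow_mult)
  finally show ?case .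
qed simp

context extra_special_group
begin

text \<open>As \<open>h\<close> and \<open>g \<otimes> h\<close> square to 1, conjugation by
  \<open>h\<close> inverts \<open>g\<close>, so \<open>f\<close> is a homomorphism. It is onto
  because the square of \<open>g\<close> generates the centre, and both sides have 8
  elements.\<close>

lemma dihedral_8_iso:
  assumes p: "p = 2" and ord: "order G = p ^ 3"
    and g: "g \<in> carrier G" and h: "h \<in> carrier G" and gh: "commutator g h \<noteq> \<one>"
    and g2: "g [^] (2::nat) \<noteq> \<one>" and h2: "h [^] (2::nat) = \<one>" and gh2: "(g \<otimes> h) [^] (2::nat) = \<one>"
  shows "G \<cong> dihedral_8"
proof -
  define f where "f = (\<lambda>(a::int, s::nat). g [^] a \<otimes> h [^] s)"
  have g4: "g [^] (4::int) = \<one>"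
  proof -
    have "g [^] (4::nat) = (g [^] p) [^] p" using g by (simp add: nat_pow_pow p)
    then show ?thesis using center_pow_p[OF pow_p_central[OF g]] int_pow_int[of G g 4] by simp
  qed
  have g_mod: "g [^] (a mod 4) = g [^] a" for a :: int
  proof -
    have "g [^] a = g [^] (4 * (a div 4) + a mod 4)" by simp
    also have "\<dots> = g [^] (a mod 4)"
      unfolding int_pow_mult[OF g] int_pow_pow[OF g, symmetric] g4 using g by simp
    finally show ?thesis ..
  qed
  have hh: "h \<otimes> h = \<one>" using h2 h by (simp add: numeral_2_eq_2)
  have h_mod: "h [^] (s mod 2) = h [^] s" for s :: nat
  proof -
    have "h [^] s = h [^] (2 * (s div 2) + s mod 2)" by simp
    also have "\<dots> = h [^] (s mod 2)"
      unfolding nat_pow_mult[OF h, symmetric] nat_pow_pow[OF h, symmetric] h2 using h by simp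
    finally show ?thesis ..
  qed
  have "h \<otimes> g \<otimes> inv h = inv g"
  proof -
    have "g \<otimes> (h \<otimes> g \<otimes> h) = \<one>" using gh2 g h by (simp add: numeral_2_eq_2 m_assoc)
    then have "h \<otimes> g \<otimes> h = inv g" using g h by (metis inv_equality inv_inv m_closed)
    moreover have "inv h = h" using hh h by (simp add: inv_equality)
    ultimately show ?thesis by simp
  qed
  then have hg: "h \<otimes> g = inv g \<otimes> h" using g h by (metis inv_closed inv_solve_right m_closed)
  have hga: "h \<otimes> g [^] a = g [^] (- a) \<otimes> h" for a :: int
  proof -
    have conj_hom: "(\<lambda>x. h \<otimes> x \<otimes> inv h) \<in> hom G G"
      by (rule homI) (use h in \<open>auto simp: m_assoc simp flip: m_assoc[of "inv h" h]\<close>)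
    have "h \<otimes> g [^] a \<otimes> inv h = (h \<otimes> g \<otimes> inv h) [^] a"
      using hom_int_pow[OF conj_hom g is_group is_group] .
    also have "\<dots> = g [^] (- a)"
      using \<open>h \<otimes> g \<otimes> inv h = inv g\<close> g by (simp add: int_pow_inv int_pow_neg)
    finally show ?thesis using g h by (metis int_pow_closed inv_solve_right m_closed)
  qed
  have hsg: "h [^] s \<otimes> g [^] b = g [^] ((- 1) ^ s * b) \<otimes> h [^] s" if "s < 2" for s :: nat and b :: int
    using that hga g h by (cases "s = 0") (auto simp: less_2_cases_iff)
  have closed: "u \<otimes>\<^bsub>dihedral_8\<^esub> v \<in> carrier dihedral_8"
    if "u \<in> carrier dihedral_8" "v \<in> carrier dihedral_8" for u v
    using that by (auto simp: dihedral_8_def)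
  have f_hom: "f (u \<otimes>\<^bsub>dihedral_8\<^esub> v) = f u \<otimes> f v" if "u \<in> carrier dihedral_8" "v \<in> carrier dihedral_8" for u v
  proof -
    obtain a s b t where u: "u = (a, s)" "v = (b, t)" by (cases u; cases v) auto
    have s: "s < 2" using that u by (auto simp: dihedral_8_def)
    have "f (u \<otimes>\<^bsub>dihedral_8\<^esub> v) = g [^] (a + (- 1) ^ s * b) \<otimes> h [^] (s + t)"
      by (simp add: f_def u dihedral_8_def g_mod h_mod)
    also have "\<dots> = g [^] a \<otimes> (g [^] ((- 1) ^ s * b) \<otimes> h [^] s) \<otimes> h [^] t"
      using g h by (simp add: int_pow_mult m_assoc flip: nat_pow_mult)
    also have "\<dots> = f u \<otimes> f v"
      unfolding hsg[OF s, symmetric] using g h by (simp add: f_def u m_assoc)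
    finally show ?thesis .
  qed
  have surj: "f ` carrier dihedral_8 = carrier G"
  proof
    show "f ` carrier dihedral_8 \<subseteq> carrier G" using g h by (auto simp: f_def)
    show "carrier G \<subseteq> f ` carrier dihedral_8"
    proof
      fix x assume "x \<in> carrier G"
      then obtain z and i j :: nat where z: "z \<in> group_center G" "j < p" "x = z \<otimes> g [^] i \<otimes> h [^] j"
        using decomposition_center[OF ord g h gh] by metis
      obtain k :: nat where k: "z = (g [^] (2::nat)) [^] k"
        using center_generated[of "g [^] p" z] pow_p_central[OF g] g2 z(1) p by auto
      have "z \<otimes> g [^] i = g [^] (2 * k + i)" using k g by (simp add: nat_pow_pow nat_pow_mult)
      then have "x = f (int (2 * k + i) mod 4, j)"
        using z(3) by (simp only: f_def g_mod int_pow_int split)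
      moreover have "(int (2 * k + i) mod 4, j) \<in> carrier dihedral_8" using z(2) p by (auto simp: dihedral_8_def)
      ultimately show "x \<in> f ` carrier dihedral_8" by blast
    qed
  qed
  have fin: "finite (carrier dihedral_8)" and "card (carrier dihedral_8) = 8"
    by (auto simp: dihedral_8_def card_cartesian_product)
  then have "card (f ` carrier dihedral_8) = card (carrier dihedral_8)"
    using surj ord p by (simp add: order_def)
  then have inj: "inj_on f (carrier dihedral_8)" using fin eq_card_imp_inj_on by blast
  \<comment> \<open>The isomorphism is wanted from \<open>G\<close>; inverting \<open>f\<close> by
    hand avoids checking the group axioms for \<open>dihedral_8\<close>.\<close>
  define f' where "f' = inv_into (carrier dihedral_8) f"
  have f': "f' x \<in> carrier dihedral_8" "f (f' x) = x" if "x \<in> carrier G" for x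
    using that surj by (auto simp: f'_def inv_into_into f_inv_into_f)
  have "f' \<in> hom G dihedral_8"
  proof (rule homI)
    show "f' (x \<otimes> y) = f' x \<otimes>\<^bsub>dihedral_8\<^esub> f' y" if xy: "x \<in> carrier G" "y \<in> carrier G" for x y
      by (rule inj_onD[OF inj]) (use f' f_hom closed xy in auto)
  qed (use f' in auto)
  moreover have "bij_betw f' (carrier G) (carrier dihedral_8)"
    unfolding f'_def using inj surj bij_betw_inv_into by (metis bij_betw_def)
  ultimately show ?thesis unfolding is_iso_def iso_def by blast
qed

text \<open>If \<open>h\<close> does not commute with \<open>g\<close>, neither does
  \<open>g \<otimes> h\<close>, and one of the two works. For odd \<open>p\<close> the commutator
  factor in \<open>mult_nat_pow\<close> vanishes, as \<open>p\<close> divides p(p-1)/2, so both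
  \<open>p\<close>-th powers cannot be trivial; for \<open>p = 2\<close> that would make the group
  dihedral.\<close>

lemma noncommuting_pair_pow_p:
  assumes ord: "order G = p ^ 3" and g: "g \<in> carrier G" "g [^] p \<noteq> \<one>"
    and not_dihedral: "\<not> (p = 2 \<and> G \<cong> dihedral_8)"
  obtains h where "h \<in> carrier G" "commutator g h \<noteq> \<one>" "h [^] p \<noteq> \<one>"
proof -
  have "g \<notin> group_center G" using g center_pow_p by blast
  then obtain h where h: "h \<in> carrier G" "commutator g h \<noteq> \<one>"
    using g(1) by (auto simp: group_center_def commutator_eq_one_iff)
  have gh: "commutator g (g \<otimes> h) \<noteq> \<one>"
  proof -
    have "commutator (g \<otimes> h) g = commutator h g" using g h by (simp add: commutator_mult_left')
    moreover have "commutator h g \<noteq> \<one>" using h commutator_swap[OF g(1) h(1)] g(1) by (metis commutator_closed inv_eq_1_iff)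
    ultimately show ?thesis using commutator_swap[of g "g \<otimes> h"] g h by (metis commutator_closed inv_eq_1_iff m_closed)
  qed
  have "h [^] p \<noteq> \<one> \<or> (g \<otimes> h) [^] p \<noteq> \<one>"
  proof (cases "p = 2")
    case True
    then show ?thesis using dihedral_8_iso[OF True ord g(1) h] g(2) not_dihedral by auto
  next
    case False
    then have "odd p" using prime_p prime_odd_nat p_gt_1 by (metis nat_less_le not_less_eq_eq numeral_2_eq_2 One_nat_def Suc_leI)
    then have "p * (p - 1) div 2 = p * ((p - 1) div 2)" by (simp add: div_mult_swap)
    then have "commutator h g [^] (p * (p - 1) div 2) = \<one>"
      using center_pow_p[OF commutator_central[OF h(1) g(1)]] h g by (simp flip: nat_pow_pow)
    then have "(g \<otimes> h) [^] p = g [^] p \<otimes> h [^] p"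
      using mult_nat_pow[OF g(1) h(1), of p] g h by simp
    then show ?thesis using g by auto
  qed
  then show ?thesis using that[of h] that[of "g \<otimes> h"] h gh g by auto
qed

end

section \<open>Irreducible projective representations\<close>

lemma linear_simps:
  assumes "Vector_Spaces.linear scale scale T"
  shows "T (x + y) = T x + T y" "T (scale c x) = scale c (T x)" "T 0 = 0"
proof -
  interpret T: Vector_Spaces.linear scale scale T by (rule assms)
  show "T (x + y) = T x + T y" "T (scale c x) = scale c (T x)" "T 0 = 0"
    by (rule T.add T.scale T.zero)+
qed

context
  fixes scale :: "complex \<Rightarrow> 'v::ab_group_add \<Rightarrow> 'v" and T :: "'v \<Rightarrow> 'v"
  assumes vs: "vector_space scale" and T: "Vector_Spaces.linear scale scale T"
begin

interpretation V: vector_space scale by (rule vs)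

text \<open>The vector q(T) v, evaluated by Horner's rule.\<close>

private definition poly_apply :: "complex poly \<Rightarrow> 'v \<Rightarrow> 'v" where
  "poly_apply q v = fold_coeffs (\<lambda>a w. scale a v + T w) q 0"

private lemma poly_apply_pCons: "poly_apply (pCons a q) v = scale a v + T (poly_apply q v)"
  \<comment> \<open>\<open>pCons 0 0\<close> is the zero polynomial, over which the fold takes no
    step; there the claim reduces to \<open>T 0 = 0\<close>.\<close>
  by (cases "a = 0 \<and> q = 0") (auto simp: poly_apply_def linear_simps[OF T])

private lemma poly_apply_0: "poly_apply 0 v = 0"
  by (simp add: poly_apply_def)

private lemma poly_apply_add: "poly_apply (q + r) v = poly_apply q v + poly_apply r v"
  by (induction q r rule: poly_induct2)
    (simp_all add: poly_apply_pCons poly_apply_0 linear_simps[OF T] V.scale_left_distrib algebra_simps)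

private lemma poly_apply_smult: "poly_apply (Polynomial.smult c q) v = scale c (poly_apply q v)"
  by (induction q) (simp_all add: poly_apply_pCons poly_apply_0 linear_simps[OF T] V.scale_right_distrib)

private lemma poly_apply_monom: "poly_apply (Polynomial.monom 1 n) v = (T ^^ n) v"
  by (induction n) (simp_all add: poly_apply_pCons poly_apply_0 linear_simps[OF T] monom_0 monom_Suc)

text \<open>Split off a root: q = (X - \<mu>) r. Either r(T) v is an eigenvector for
  \<open>\<mu>\<close>, or r annihilates \<open>v\<close> and has smaller degree.\<close>

private lemma eigenvector_of_annihilating_poly:
  assumes "q \<noteq> 0" "poly_apply q v = 0" "v \<noteq> 0"
  shows "\<exists>\<mu> w. w \<noteq> 0 \<and> T w = scale \<mu> w"
  using assms
proof (induction "Polynomial.degree q" arbitrary: q)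
  case 0
  then obtain c where "q = [:c:]" "c \<noteq> 0" by (metis degree_eq_zeroE pCons_0_0)
  then show ?case using 0 by (simp add: poly_apply_pCons poly_apply_0 linear_simps[OF T])
next
  case (Suc n)
  then have "\<not> constant (poly q)" by (simp add: constant_degree)
  then obtain \<mu> where "poly q \<mu> = 0" using fundamental_theorem_of_algebra by blast
  then obtain r where r: "q = [:- \<mu>, 1:] * r" by (metis dvdE poly_eq_0_iff_dvd)
  then have "r \<noteq> 0" using Suc.prems(1) by auto
  then have deg: "Polynomial.degree r = n" using Suc.hyps(2) r by (simp add: degree_mult_eq del: mult_pCons_left)
  have "q = Polynomial.smult (- \<mu>) r + pCons 0 r" by (simp add: r)
  then have "scale (- \<mu>) (poly_apply r v) + T (poly_apply r v) = 0"
    using Suc.prems(2) by (simp add: poly_apply_add poly_apply_smult poly_apply_pCons del: smult_minus_left)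
  then have "T (poly_apply r v) = scale \<mu> (poly_apply r v)" by simp
  then show ?case
    using Suc.hyps(1)[of r] deg \<open>r \<noteq> 0\<close> Suc.prems(3) by blast
qed

text \<open>The polynomial X^n - c annihilates \<open>v\<close>. This takes the place of a
  characteristic polynomial, as the space may be infinite-dimensional.\<close>

lemma eigenvector_of_scalar_power:
  assumes "n > 0" "(T ^^ n) v = scale c v" "v \<noteq> 0"
  shows "\<exists>\<mu> w. w \<noteq> 0 \<and> T w = scale \<mu> w"
proof (rule eigenvector_of_annihilating_poly)
  let ?q = "Polynomial.monom 1 n + [:- c:]"
  have "Polynomial.coeff ?q n = 1" using assms(1) by (simp add: coeff_pCons split: nat.split)
  then show "?q \<noteq> 0" by (metis coeff_0 zero_neq_one)
  show "poly_apply ?q v = 0"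
    using assms(2) by (simp add: poly_apply_add poly_apply_monom poly_apply_pCons poly_apply_0 linear_simps[OF T])
qed (rule assms(3))

end

text \<open>The scalars are chosen separately for each pair; the cocycle identity follows by
  evaluating a triple product on a nonzero vector in two ways.\<close>

lemma projective_rep_of_scalar_relation:
  fixes scale :: "complex \<Rightarrow> 'v::ab_group_add \<Rightarrow> 'v"
  assumes "group Q" and vs: "vector_space scale" and nontriv: "(UNIV :: 'v set) \<noteq> {0}"
    and lin: "\<And>x. x \<in> carrier Q \<Longrightarrow> Vector_Spaces.linear scale scale (\<sigma> x) \<and> bij (\<sigma> x)"
    and rel: "\<And>x y. x \<in> carrier Q \<Longrightarrow> y \<in> carrier Q \<Longrightarrow>
      \<exists>c. c \<noteq> 0 \<and> (\<forall>v. \<sigma> x (\<sigma> y v) = scale c (\<sigma> (x \<otimes>\<^bsub>Q\<^esub> y) v))"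
  shows "\<exists>\<beta>. projective_rep Q scale \<sigma> \<beta>"
proof -
  interpret Q: group Q by (rule assms)
  interpret V: vector_space scale by (rule vs)
  define \<beta> where "\<beta> x y = (SOME c. c \<noteq> 0 \<and> (\<forall>v. \<sigma> x (\<sigma> y v) = scale c (\<sigma> (x \<otimes>\<^bsub>Q\<^esub> y) v)))" for x y
  have \<beta>: "\<beta> x y \<noteq> 0" "\<sigma> x (\<sigma> y v) = scale (\<beta> x y) (\<sigma> (x \<otimes>\<^bsub>Q\<^esub> y) v)"
    if "x \<in> carrier Q" "y \<in> carrier Q" for x y v
    using someI_ex[OF rel[OF that]] unfolding \<beta>_def by blast+
  obtain v :: 'v where v: "v \<noteq> 0" using nontriv by auto
  have "\<beta> x y * \<beta> (x \<otimes>\<^bsub>Q\<^esub> y) z = \<beta> y z * \<beta> x (y \<otimes>\<^bsub>Q\<^esub> z)"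
    if xyz: "x \<in> carrier Q" "y \<in> carrier Q" "z \<in> carrier Q" for x y z
  proof -
    let ?w = "\<sigma> (x \<otimes>\<^bsub>Q\<^esub> y \<otimes>\<^bsub>Q\<^esub> z) v"
    have "\<sigma> (x \<otimes>\<^bsub>Q\<^esub> y \<otimes>\<^bsub>Q\<^esub> z) 0 = 0" "inj (\<sigma> (x \<otimes>\<^bsub>Q\<^esub> y \<otimes>\<^bsub>Q\<^esub> z))"
      using lin[of "x \<otimes>\<^bsub>Q\<^esub> y \<otimes>\<^bsub>Q\<^esub> z"] linear_simps(3) xyz by (auto simp: bij_is_inj)
    then have "?w \<noteq> 0" using v by (metis injD)
    moreover have "\<sigma> x (\<sigma> y (\<sigma> z v)) = scale (\<beta> x y * \<beta> (x \<otimes>\<^bsub>Q\<^esub> y) z) ?w"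
      using \<beta>(2)[OF xyz(1,2), of "\<sigma> z v"] \<beta>(2)[of "x \<otimes>\<^bsub>Q\<^esub> y" z v] xyz by simp
    moreover have "\<sigma> x (\<sigma> y (\<sigma> z v)) = scale (\<beta> y z * \<beta> x (y \<otimes>\<^bsub>Q\<^esub> z)) ?w"
    proof -
      have "\<sigma> x (\<sigma> y (\<sigma> z v)) = scale (\<beta> y z) (\<sigma> x (\<sigma> (y \<otimes>\<^bsub>Q\<^esub> z) v))"
        using xyz lin linear_simps(2) by (metis \<beta>(2))
      then show ?thesis using xyz by (simp add: \<beta>(2) Q.m_assoc)
    qed
    ultimately show ?thesis by (metis V.scale_right_imp_eq)
  qed
  with \<beta> lin have "projective_rep Q scale \<sigma> \<beta>"
    by (auto simp: projective_rep_def two_cocycle_def)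
  then show ?thesis by blast
qed

section \<open>Schur's lemma and descent to a quotient\<close>

lemma (in group) projective_rep_one:
  assumes "projective_rep G scale \<rho> \<alpha>"
  shows "\<rho> \<one> v = scale (\<alpha> \<one> \<one>) v"
proof -
  have "bij (\<rho> \<one>)" using assms by (simp add: projective_rep_def)
  then obtain u where "v = \<rho> \<one> u" by (metis bij_pointE)
  then show ?thesis using assms one_closed unfolding projective_rep_def by (metis l_one)
qed

lemma (in group) projective_rep_pow:
  assumes vs: "vector_space scale" and \<rho>: "projective_rep G scale \<rho> \<alpha>" and z: "z \<in> carrier G"
  shows "\<exists>c. \<forall>v. (\<rho> z ^^ k) v = scale c (\<rho> (z [^] k) v)"
proof (induction k)
  interpret V: vector_space scale by (rule vs)
  case 0
  have "\<alpha> \<one> \<one> \<noteq> 0" using \<rho> by (simp add: projective_rep_def two_cocycle_def)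
  then show ?case
    using projective_rep_one[OF \<rho>] by (intro exI[of _ "inverse (\<alpha> \<one> \<one>)"]) simp
next
  interpret V: vector_space scale by (rule vs)
  case (Suc k)
  then obtain c where c: "\<And>v. (\<rho> z ^^ k) v = scale c (\<rho> (z [^] k) v)" by blast
  have "(\<rho> z ^^ Suc k) v = scale (c * \<alpha> z (z [^] k)) (\<rho> (z [^] Suc k) v)" for v
  proof -
    have "(\<rho> z ^^ Suc k) v = scale c (\<rho> z (\<rho> (z [^] k) v))"
    proof -
      have "Vector_Spaces.linear scale scale (\<rho> z)" using \<rho> z by (simp add: projective_rep_def)
      then show ?thesis using linear_simps(2) by (simp add: c)
    qed
    also have "\<rho> z (\<rho> (z [^] k) v) = scale (\<alpha> z (z [^] k)) (\<rho> (z \<otimes> z [^] k) v)"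
      using \<rho> z by (simp add: projective_rep_def)
    finally show ?thesis using nat_pow_Suc2[OF z, of k] by simp
  qed
  then show ?case by blast
qed

text \<open>Symmetry of \<open>\<alpha>\<close> at \<open>z\<close> makes \<open>\<rho> z\<close>
  commute with every \<open>\<rho> x\<close>. Since \<open>z\<close> has finite order, a power of
  \<open>\<rho> z\<close> is scalar, which yields an eigenvector; its eigenspace is a nonzero
  invariant subspace.\<close>

lemma (in group) irreducible_projective_rep_scalar:
  fixes scale :: "complex \<Rightarrow> 'v::ab_group_add \<Rightarrow> 'v"
  assumes vs: "vector_space scale" and irr: "irreducible_projective_rep G scale \<rho>"
    and \<rho>: "projective_rep G scale \<rho> \<alpha>" and z: "z \<in> group_center G"
    and torsion: "k > 0" "z [^] (k::nat) = \<one>"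
    and sym: "\<And>x. x \<in> carrier G \<Longrightarrow> \<alpha> z x = \<alpha> x z"
  shows "\<exists>\<mu>. \<mu> \<noteq> 0 \<and> (\<forall>v. \<rho> z v = scale \<mu> v)"
proof -
  interpret V: vector_space scale by (rule vs)
  have zc: "z \<in> carrier G" using z group_center_closed by blast
  have lin: "Vector_Spaces.linear scale scale (\<rho> x)" "bij (\<rho> x)" if "x \<in> carrier G" for x
    using \<rho> that by (auto simp: projective_rep_def)
  have commute: "\<rho> z (\<rho> x v) = \<rho> x (\<rho> z v)" if "x \<in> carrier G" for x v
    using \<rho> that zc sym[OF that] group_center_commute[OF z that] by (simp add: projective_rep_def)
  obtain v :: 'v where v: "v \<noteq> 0" using irr by (auto simp: irreducible_projective_rep_def)
  obtain c where "(\<rho> z ^^ k) v = scale c v"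
    using projective_rep_pow[OF vs \<rho> zc, of k] projective_rep_one[OF \<rho>] torsion(2) by (metis V.scale_scale)
  then obtain \<mu> w where w: "w \<noteq> 0" "\<rho> z w = scale \<mu> w"
    using eigenvector_of_scalar_power[OF vs lin(1)[OF zc] torsion(1) _ v] by blast
  define W where "W = {u. \<rho> z u = scale \<mu> u}"
  have "V.subspace W"
    using linear_simps[OF lin(1)[OF zc]]
    by (auto simp: V.subspace_def W_def V.scale_right_distrib V.scale_left_commute)
  moreover have "\<rho> x ` W \<subseteq> W" if "x \<in> carrier G" for x
    using commute[OF that] linear_simps(2)[OF lin(1)[OF that]] by (auto simp: W_def)
  ultimately have "W = {0} \<or> W = UNIV"
    using irr by (simp add: irreducible_projective_rep_def)
  moreover have "w \<in> W" using w by (simp add: W_def)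
  ultimately have "W = UNIV" using w by auto
  then have all: "\<rho> z u = scale \<mu> u" for u by (auto simp: W_def)
  have "\<mu> \<noteq> 0"
  proof
    assume "\<mu> = 0"
    then have "\<rho> z w = \<rho> z 0" using all by simp
    then show False using lin(2)[OF zc] w(1) by (metis bij_pointE)
  qed
  with all show ?thesis by blast
qed

text \<open>\<open>\<sigma>\<close> evaluates \<open>\<rho>\<close> at an arbitrary representative
  of the coset. Another representative differs by an element of \<open>N\<close> and changes the
  operator only by a scalar, so the identity map intertwines \<open>\<rho>\<close> with the
  inflation up to the scalars \<open>b\<close>.\<close>

lemma (in group) irreducible_projective_rep_deflate:
  fixes scale :: "complex \<Rightarrow> 'v::ab_group_add \<Rightarrow> 'v"
  assumes vs: "vector_space scale" and irr: "irreducible_projective_rep G scale \<rho>"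
    and N: "N \<lhd> G"
    and scalar: "\<And>z. z \<in> N \<Longrightarrow> \<exists>\<mu>. \<mu> \<noteq> 0 \<and> (\<forall>v. \<rho> z v = scale \<mu> v)"
  shows "\<exists>\<sigma>. irreducible_projective_rep (G Mod N) scale \<sigma> \<and>
           projectively_equivalent G scale \<rho> scale (inflation G N \<sigma>)"
proof -
  interpret V: vector_space scale by (rule vs)
  interpret N: normal N G by (rule N)
  obtain \<alpha> where \<rho>: "projective_rep G scale \<rho> \<alpha>"
    using irr by (auto simp: irreducible_projective_rep_def)
  have lin: "Vector_Spaces.linear scale scale (\<rho> x)" "bij (\<rho> x)" if "x \<in> carrier G" for x
    using \<rho> that by (auto simp: projective_rep_def)
  have nz: "\<alpha> x y \<noteq> 0" and mult: "\<rho> x (\<rho> y v) = scale (\<alpha> x y) (\<rho> (x \<otimes> y) v)"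
    if "x \<in> carrier G" "y \<in> carrier G" for x y v
    using \<rho> that by (auto simp: projective_rep_def two_cocycle_def)
  define r where "r C = (SOME x. x \<in> C)" for C :: "'a set"
  define \<sigma> where "\<sigma> C = \<rho> (r C)" for C
  have r: "r (N #> x) \<in> N #> x" if "x \<in> carrier G" for x
    unfolding r_def using rcos_self[OF that N.is_subgroup] by (rule someI)
  have rc: "r (N #> x) \<in> carrier G" if "x \<in> carrier G" for x
    using r[OF that] r_coset_subset_G[OF N.subset that] by blast
  have "\<exists>b. b \<noteq> 0 \<and> (\<forall>v. \<sigma> (N #> x) v = scale b (\<rho> x v))" if x: "x \<in> carrier G" for x
  proof -
    obtain z where z: "z \<in> N" "r (N #> x) = z \<otimes> x" using r[OF x] by (auto simp: r_coset_def)
    obtain \<mu> where \<mu>: "\<mu> \<noteq> 0" "\<And>v. \<rho> z v = scale \<mu> v" using scalar[OF z(1)] by blast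
    have zc: "z \<in> carrier G" using z N.mem_carrier by blast
    have "\<sigma> (N #> x) v = scale (inverse (\<alpha> z x) * \<mu>) (\<rho> x v)" for v
    proof -
      have "scale \<mu> (\<rho> x v) = scale (\<alpha> z x) (\<sigma> (N #> x) v)"
        using mult[OF zc x, of v] \<mu>(2) z(2) by (simp add: \<sigma>_def)
      then have "scale (inverse (\<alpha> z x)) (scale \<mu> (\<rho> x v)) = \<sigma> (N #> x) v"
        using nz[OF zc x] by simp
      then show ?thesis by simp
    qed
    then show ?thesis using \<mu>(1) nz[OF zc x] by (intro exI[of _ "inverse (\<alpha> z x) * \<mu>"]) simp
  qed
  then obtain b where b: "\<And>x. x \<in> carrier G \<Longrightarrow> b x \<noteq> 0"
    "\<And>x v. x \<in> carrier G \<Longrightarrow> \<sigma> (N #> x) v = scale (b x) (\<rho> x v)"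
    by metis
  have nontriv: "(UNIV :: 'v set) \<noteq> {0}" using irr by (simp add: irreducible_projective_rep_def)
  have "\<exists>\<beta>. projective_rep (G Mod N) scale \<sigma> \<beta>"
  proof (rule projective_rep_of_scalar_relation[OF N.factorgroup_is_group vs nontriv])
    show "Vector_Spaces.linear scale scale (\<sigma> C) \<and> bij (\<sigma> C)" if "C \<in> carrier (G Mod N)" for C
      using that lin rc by (auto simp: carrier_FactGroup \<sigma>_def)
    show "\<exists>c. c \<noteq> 0 \<and> (\<forall>v. \<sigma> C (\<sigma> D v) = scale c (\<sigma> (C \<otimes>\<^bsub>G Mod N\<^esub> D) v))"
      if CD: "C \<in> carrier (G Mod N)" "D \<in> carrier (G Mod N)" for C D
    proof -
      obtain x y where xy: "x \<in> carrier G" "y \<in> carrier G" "C = N #> x" "D = N #> y"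
        using CD by (auto simp: carrier_FactGroup)
      have prod: "C \<otimes>\<^bsub>G Mod N\<^esub> D = N #> (x \<otimes> y)" using xy by (simp add: N.rcos_sum)
      \<comment> \<open>The factors \<open>b x\<close> and \<open>b y\<close> pass from
        \<open>\<sigma>\<close> to \<open>\<rho>\<close>, and the division by
        \<open>b (x \<otimes> y)\<close> passes back.\<close>
      define c where "c = b x * b y * \<alpha> x y / b (x \<otimes> y)"
      have "\<sigma> C (\<sigma> D v) = scale c (\<sigma> (C \<otimes>\<^bsub>G Mod N\<^esub> D) v)" for v
        unfolding prod unfolding xy(3,4) c_def
        using xy(1,2) b linear_simps(2)[OF lin(1)[OF xy(1)]] mult[OF xy(1,2)] by simp
      moreover have "c \<noteq> 0" using xy b nz by (simp add: c_def)
      ultimately show ?thesis by blast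
    qed
  qed
  moreover have "W = {0} \<or> W = UNIV"
    if W: "V.subspace W" "\<forall>C \<in> carrier (G Mod N). \<sigma> C ` W \<subseteq> W" for W
  proof -
    have "\<rho> x ` W \<subseteq> W" if x: "x \<in> carrier G" for x
    proof
      fix u assume "u \<in> \<rho> x ` W"
      then obtain w where w: "w \<in> W" "u = \<rho> x w" by blast
      have "\<sigma> (N #> x) w \<in> W" using W(2) w(1) x by (auto simp: carrier_FactGroup)
      then have "scale (inverse (b x)) (\<sigma> (N #> x) w) \<in> W" using V.subspace_scale[OF W(1)] by blast
      then show "u \<in> W" using b[OF x] w(2) by simp
    qed
    then show ?thesis using irr W(1) by (simp add: irreducible_projective_rep_def)
  qed
  ultimately have "irreducible_projective_rep (G Mod N) scale \<sigma>"
    using nontriv by (simp add: irreducible_projective_rep_def)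
  moreover have "projectively_equivalent G scale \<rho> scale (inflation G N \<sigma>)"
    unfolding projectively_equivalent_def
  proof (intro exI[of _ id] exI[of _ b] conjI ballI allI)
    show "Vector_Spaces.linear scale scale id" by (rule V.linear_id)
    show "scale (b x) (id (\<rho> x (inv_into UNIV id w))) = inflation G N \<sigma> x w" if "x \<in> carrier G" for x w
      using b(2)[OF that] by (simp add: inflation_def inv_id)
  qed (use b in auto)
  ultimately show ?thesis by blast
qed

section \<open>Elementary abelian groups\<close>

text \<open>One factor is adjoined at a time. As long as \<open>k < m\<close>, counting gives some
  \<open>a\<close> outside the image of the first \<open>k\<close> factors, and the new coordinate
  becomes the exponent of \<open>a\<close>.\<close>

lemma (in comm_group) elementary_abelian_embedding:
  assumes p: "Factorial_Ring.prime p" and exp: "\<And>x. x \<in> carrier G \<Longrightarrow> x [^] p = \<one>"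
    and ord: "order G = p ^ m" and "k \<le> m"
  shows "\<exists>f. f \<in> hom (product_group {..<k} (\<lambda>_. integer_mod_group p)) G \<and>
           inj_on f (carrier (product_group {..<k} (\<lambda>_. integer_mod_group p)))"
  using \<open>k \<le> m\<close>
proof (induction k)
  case 0
  show ?case by (rule exI[of _ "\<lambda>_. \<one>"]) (auto simp: hom_def)
next
  case (Suc k)
  let ?P = "\<lambda>k. product_group {..<k::nat} (\<lambda>_. integer_mod_group p)"
  obtain f where f: "f \<in> hom (?P k) G" "inj_on f (carrier (?P k))" using Suc by auto
  have p0: "p > 0" using p prime_gt_0_nat by blast
  have P: "group (?P k)" for k by simp
  interpret f: group_hom "?P k" G f
    using f(1) P is_group by (simp add: group_hom_def group_hom_axioms_def)
  have car: "carrier (integer_mod_group p) = {0..<int p}" using p0 by (simp add: carrier_integer_mod_group)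
  have "card (carrier (?P k)) = p ^ k" by (simp add: card_PiE car)
  then have "card (f ` carrier (?P k)) = p ^ k" using f(2) by (simp add: card_image)
  also have "\<dots> < p ^ m" using Suc.prems p prime_gt_1_nat by (intro power_strict_increasing) auto
  finally have "f ` carrier (?P k) \<noteq> carrier G" using ord by (auto simp: order_def)
  then obtain a where a: "a \<in> carrier G" "a \<notin> f ` carrier (?P k)" using f.hom_closed by blast
  have img: "subgroup (f ` carrier (?P k)) G" by (rule f.img_is_subgroup)
  \<comment> \<open>Coordinates are added modulo \<open>p\<close>, so \<open>F\<close> is
    multiplicative only if exponents of \<open>a\<close> may be reduced modulo
    \<open>p\<close>.\<close>
  have a_pow: "a [^] (d mod int p) = a [^] d" for d :: int
  proof -
    have "a [^] d = a [^] (int p * (d div int p) + d mod int p)" by simp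
    also have "\<dots> = a [^] (d mod int p)"
      unfolding int_pow_mult[OF a(1)] int_pow_pow[OF a(1), symmetric] int_pow_int exp[OF a(1)] using a(1) by simp
    finally show ?thesis ..
  qed
  define F where "F e = f (restrict e {..<k}) \<otimes> a [^] (e k)" for e :: "nat \<Rightarrow> int"
  have restr: "restrict e {..<k} \<in> carrier (?P k)" if "e \<in> carrier (?P (Suc k))" for e
    using that by (auto simp: PiE_iff)
  have hom: "F \<in> hom (?P (Suc k)) G"
  proof (rule homI)
    show "F e \<in> carrier G" if "e \<in> carrier (?P (Suc k))" for e
      using f.hom_closed[OF restr[OF that]] a(1) unfolding F_def by simp
    show "F (d \<otimes>\<^bsub>?P (Suc k)\<^esub> e) = F d \<otimes> F e" if "d \<in> carrier (?P (Suc k))" "e \<in> carrier (?P (Suc k))" for d e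
    proof -
      have "restrict (d \<otimes>\<^bsub>?P (Suc k)\<^esub> e) {..<k} = restrict d {..<k} \<otimes>\<^bsub>?P k\<^esub> restrict e {..<k}"
        by (auto simp: fun_eq_iff)
      then have "f (restrict (d \<otimes>\<^bsub>?P (Suc k)\<^esub> e) {..<k}) = f (restrict d {..<k}) \<otimes> f (restrict e {..<k})"
        using f.hom_mult[OF restr[OF that(1)] restr[OF that(2)]] by simp
      moreover have "a [^] ((d \<otimes>\<^bsub>?P (Suc k)\<^esub> e) k) = a [^] d k \<otimes> a [^] e k"
        using a(1) by (simp add: a_pow int_pow_mult)
      moreover have "f (restrict d {..<k}) \<in> carrier G" "f (restrict e {..<k}) \<in> carrier G"
        using restr that f.hom_closed by blast+
      ultimately show ?thesis unfolding F_def using a(1) by (simp add: m_ac)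
    qed
  qed
  interpret F: group_hom "?P (Suc k)" G F
    using hom P is_group by (simp add: group_hom_def group_hom_axioms_def)
  have "e = \<one>\<^bsub>?P (Suc k)\<^esub>" if e: "e \<in> carrier (?P (Suc k))" "F e = \<one>" for e
  proof -
    let ?r = "restrict e {..<k}"
    have r: "?r \<in> carrier (?P k)" using restr[OF e(1)] .
    have ek: "0 \<le> e k" "e k < int p" using e(1) car by (auto simp: PiE_iff)
    have inv: "f ?r = inv (a [^] e k)"
      using e(2) r f.hom_closed[OF r] a(1) unfolding F_def by (metis int_pow_closed inv_equality)
    have zero: "e k = 0"
    proof (rule ccontr)
      assume "e k \<noteq> 0"
      then have "coprime (e k) (int p)"
        using ek p prime_imp_coprime[of "int p" "e k"] zdvd_imp_le[of "int p" "e k"]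
        by (auto simp: coprime_commute)
      \<comment> \<open>A nonzero exponent is invertible modulo \<open>p\<close>; raising to the
        power \<open>u\<close> would put \<open>a\<close> itself into the image.\<close>
      then obtain u v where uv: "u * e k + v * int p = 1" using bezout_int[of "e k" "int p"] by (auto simp: coprime_iff_gcd_eq_1)
      have "a [^] e k = inv (f ?r)" unfolding inv using a(1) by simp
      also have "inv (f ?r) \<in> f ` carrier (?P k)" by (intro subgroup.m_inv_closed[OF img] imageI r)
      finally have "a [^] e k \<in> f ` carrier (?P k)" .
      then have "(a [^] e k) [^] u \<in> f ` carrier (?P k)" by (rule subgroup_int_pow_closed[OF img])
      moreover have "(a [^] e k) [^] u = a"
      proof -
        have "(a [^] e k) [^] u = a [^] ((u * e k) mod int p)"
          using a(1) by (simp add: a_pow int_pow_pow mult.commute)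
        also have "(u * e k) mod int p = 1 mod int p" by (metis uv mod_mult_self2 mult.commute)
        finally show ?thesis using a(1) by (simp add: a_pow)
      qed
      ultimately show False using a(2) by simp
    qed
    then have "f ?r = \<one>" using inv a(1) by simp
    then have "?r = \<one>\<^bsub>?P k\<^esub>" using f(2) r f.inj_on_one_iff by blast
    then have "e i = 0" if "i < k" for i using that by (metis lessThan_iff one_integer_mod_group one_product_group restrict_apply')
    then have "e i = 0" if "i < Suc k" for i using that zero less_Suc_eq by auto
    then show ?thesis using e(1) by (auto simp: fun_eq_iff PiE_iff extensional_def)
  qed
  then have "inj_on F (carrier (?P (Suc k)))" using F.inj_on_one_iff by blast
  with hom show ?case by blast
qed

lemma (in comm_group) elementary_abelian_iso_product:
  assumes p: "Factorial_Ring.prime p" and exp: "\<And>x. x \<in> carrier G \<Longrightarrow> x [^] p = \<one>"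
    and ord: "order G = p ^ m"
  shows "G \<cong> product_group {..<m} (\<lambda>_. integer_mod_group p)"
proof -
  let ?P = "product_group {..<m} (\<lambda>_. integer_mod_group p)"
  obtain f where f: "f \<in> hom ?P G" "inj_on f (carrier ?P)"
    using elementary_abelian_embedding[OF p exp ord order_refl] by blast
  have p0: "p > 0" using p prime_gt_0_nat by blast
  have fin: "finite (carrier G)" using ord p0 by (intro card_ge_0_finite) (simp add: order_def)
  have "card (carrier ?P) = p ^ m" using p0 by (simp add: card_PiE carrier_integer_mod_group)
  then have "card (f ` carrier ?P) = card (carrier G)" using f(2) ord by (simp add: card_image order_def)
  moreover have "f ` carrier ?P \<subseteq> carrier G" using f(1) by (auto simp: hom_def)
  ultimately have "f ` carrier ?P = carrier G" using fin card_subset_eq by blast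
  with f have "?P \<cong> G" by (intro is_isoI isoI) (auto simp: bij_betw_def)
  moreover have "group ?P" by simp
  ultimately show ?thesis using group.iso_sym by blast
qed

text \<open>For \<open>p = 2\<close> and \<open>n = 1\<close> the predicate
  \<open>ES_p_squared\<close> also admits the dihedral group of order 8, whose Schur multiplier is
  nontrivial; hence its exclusion from the first claim.\<close>

theorem corollary1p5:
  fixes G :: "('a, 'm) monoid_scheme"
    and p n :: nat
    and scale :: "complex \<Rightarrow> 'v::ab_group_add \<Rightarrow> 'v"
  assumes "Factorial_Ring.prime p"
    and "n \<ge> 1"
    and "ES_p_squared p n G"
    and "vector_space scale"
  shows "(n = 1 \<and> \<not> (p = 2 \<and> G \<cong> dihedral_8) \<longrightarrow>
           (\<forall>\<rho> \<alpha>. projective_rep G scale \<rho> \<alpha> \<longrightarrow> equivalent_to_ordinary G \<alpha>)) \<and>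
         (n > 1 \<longrightarrow>
           (G Mod group_center G) \<cong> product_group {..<2 * n} (\<lambda>_. integer_mod_group p) \<and>
           (\<forall>\<rho>. irreducible_projective_rep G scale \<rho> \<longrightarrow>
             (\<exists>\<sigma>. irreducible_projective_rep (G Mod group_center G) scale \<sigma> \<and>
                  projectively_equivalent G scale \<rho>
                    scale (inflation G (group_center G) \<sigma>))))"
proof -
  have E: "extra_special p G" and ord: "order G = p ^ (2 * n + 1)" and exponent: "group_exponent G = p ^ 2"
    using assms(3) by (auto simp: ES_p_squared_def)
  have G: "extra_special_group G p" by (rule extra_special_group_of_extra_special[OF assms(1) E])
  interpret extra_special_group G p by (rule G)
  show ?thesis
  proof (intro conjI impI allI)
    fix \<rho> \<alpha>
    assume n: "n = 1 \<and> \<not> (p = 2 \<and> G \<cong> dihedral_8)" and \<rho>: "projective_rep G scale \<rho> \<alpha>"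
    have ord3: "order G = p ^ 3" using ord n by (simp add: numeral_3_eq_3)
    \<comment> \<open>Otherwise \<open>p\<close> would be a candidate in the minimum defining the
      exponent, against its value \<open>p ^ 2\<close>.\<close>
    have "\<exists>g \<in> carrier G. g [^]\<^bsub>G\<^esub> p \<noteq> \<one>\<^bsub>G\<^esub>"
    proof (rule ccontr)
      assume "\<not> ?thesis"
      then have "group_exponent G \<le> p"
        unfolding group_exponent_def using p_gt_1 by (intro Least_le) auto
      then show False using exponent p_gt_1 by (simp add: power2_eq_square)
    qed
    then obtain g where g: "g \<in> carrier G" "g [^]\<^bsub>G\<^esub> p \<noteq> \<one>\<^bsub>G\<^esub>" by blast
    obtain h where h: "h \<in> carrier G" "commutator g h \<noteq> \<one>\<^bsub>G\<^esub>" "h [^]\<^bsub>G\<^esub> p \<noteq> \<one>\<^bsub>G\<^esub>"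
      using noncommuting_pair_pow_p[OF ord3 g] n by blast
    have "two_cocycle G \<alpha>" using \<rho> by (simp add: projective_rep_def)
    then show "equivalent_to_ordinary G \<alpha>"
      using equivalent_to_ordinary_small[OF G ord3] g h by blast
  next
    interpret Z: normal "group_center G" G by (rule group_center_normal)
    have quot: "comm_group (G Mod group_center G)"
      and exp: "\<And>C. C \<in> carrier (G Mod group_center G) \<Longrightarrow>
        C [^]\<^bsub>(G Mod group_center G)\<^esub> p = \<one>\<^bsub>(G Mod group_center G)\<^esub>"
      using E by (auto simp: extra_special_def elementary_abelian_def)
    have "card (rcosets\<^bsub>G\<^esub> group_center G) * p = order G"
      using lagrange[OF group_center_subgroup] card_center by simp
    then have "order (G Mod group_center G) = p ^ (2 * n)"
      using ord p_gt_1 by (simp add: order_def FactGroup_def)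
    then show "(G Mod group_center G) \<cong> product_group {..<2 * n} (\<lambda>_. integer_mod_group p)"
      using comm_group.elementary_abelian_iso_product[OF quot assms(1) exp] by blast
  next
    fix \<rho> assume n: "n > 1" and irr: "irreducible_projective_rep G scale \<rho>"
    obtain \<alpha> where \<rho>: "projective_rep G scale \<rho> \<alpha>"
      using irr by (auto simp: irreducible_projective_rep_def)
    then have \<alpha>: "two_cocycle G \<alpha>" by (simp add: projective_rep_def)
    have "\<exists>\<mu>. \<mu> \<noteq> 0 \<and> (\<forall>v. \<rho> z v = scale \<mu> v)" if z: "z \<in> group_center G" for z
      using irreducible_projective_rep_scalar[OF assms(4) irr \<rho> z, of p] center_pow_p[OF z] p_gt_1
        cocycle_symmetric_large[OF G ord n \<alpha> z] by simp
    then show "\<exists>\<sigma>. irreducible_projective_rep (G Mod group_center G) scale \<sigma> \<and>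
        projectively_equivalent G scale \<rho> scale (inflation G (group_center G) \<sigma>)"
      by (rule irreducible_projective_rep_deflate[OF assms(4) irr group_center_normal])
  qed
qed

end
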